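(* Let $\Gamma=N\rtimes_\sigma H$ with $N$ a discrete abelian group and $H$ a finite group of order $\kappa$. Let $\mathsf{f}\in\ell^2(\Gamma)$ and let $\mathbf{F}(\xi)$, $\xi\in\widehat{N}$, be its associated $\kappa\times\kappa$ transfer matrix. Then the system $\{L_\gamma\mathsf{f}\}_{\gamma\in\Gamma}$ is a Bessel sequence for $\ell^2(\Gamma)$ if and only if all entries of the matrix-valued function $\mathbf{F}(\xi)$ belong to $L^\infty(\widehat{N})$. In this case the optimal Bessel bound is $$B_{\mathsf{f}}:=\operatorname*{ess\,sup}_{\xi\in\widehat{N}}\lambda_{\max}[\mathbf{F}^*(\xi)\mathbf{F}(\xi)],$$ where $\lambda_{\max}[\mathbf{F}^*(\xi)\mathbf{F}(\xi)]$ denotes the largest eigenvalue of $\mathbf{F}^*(\xi)\mathbf{F}(\xi)$.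
   Context: Setting: $(N,+)$ is a discrete abelian group, $(H,\cdot)$ is a finite group of order $\kappa$, $\sigma:H\to\mathrm{Aut}(N)$ is a homomorphism, and $\Gamma=N\rtimes_\sigma H$ is the set $N\times H$ with product $(n,h)(m,l)=(n+\sigma(h)(m),hl)$. The left regular representation of $\Gamma$ on the complex Hilbert space $\ell^2(\Gamma)$ is $L_\gamma\mathsf{f}(\eta)=\mathsf{f}(\gamma^{-1}\eta)$. $\widehat{N}$ is the (compact) dual group of $N$, with Haar measure $\mu_{\widehat N}$ normalized so that the Fourier transform $\widehat{\mathsf{a}}(\xi)=\sum_{n\in N}\mathsf{a}(n)\langle -n,\xi\rangle$, defined for $\mathsf{a}\in\ell^1(N)$, extends to a unitary operator $\ell^2(N)\to L^2(\widehat{N})$. Transfer matrix: for $\mathsf{f}\in\ell^2(\Gamma)$ and $h,l\in H$ put $\mathsf{f}_{h,l}(n):=\mathsf{f}[(0,l)^{-1}(n,h)]$, $n\in N$. The transfer matrix of $\mathsf{f}$ is $\mathbf{F}(\xi)=[\,\widehat{\mathsf{f}}_{h,l}(\xi)\,]_{h,l\in H}$ (row index $h$, column index $l$), and $\mathbf{F}^*(\xi)$ is its conjugate transpose. A system $\{x_\gamma\}_{\gamma\in\Gamma}$ in a Hilbert space is a Bessel sequence if there is $B>0$ with $\sum_\gamma|\langle x,x_\gamma\rangle|^2\le B\|x\|^2$ for all $x$ (equivalently, $\mathsf{a}\mapsto\sum_\gamma\mathsf{a}(\gamma)x_\gamma$ is a well-defined bounded operator from $\ell^2(\Gamma)$ with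 squared norm at most $B$); the optimal Bessel bound is the smallest such $B$. *)

theory Defs
  imports "HOL-Analysis.Analysis" "HOL-Probability.Essential_Supremum"
begin

text \<open>
  The finite group \<open>H\<close> is a type of class \<open>group_add\<close>, which does not assume commutativity;
  its product is therefore written \<open>+\<close> and its inverse \<open>-\<close>.
\<close>

definition automorphisms :: "('n::ab_group_add \<Rightarrow> 'n) set" where
  "automorphisms = {\<phi>. bij \<phi> \<and> (\<forall>m n. \<phi> (m + n) = \<phi> m + \<phi> n)}"

definition hom_to_Aut :: "('h::group_add \<Rightarrow> 'n::ab_group_add \<Rightarrow> 'n) \<Rightarrow> bool" where
  "hom_to_Aut \<sigma> \<longleftrightarrow> (\<forall>h. \<sigma> h \<in> automorphisms) \<and> (\<forall>h l. \<sigma> (h + l) = \<sigma> h \<circ> \<sigma> l)"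

text \<open>
  The componentwise group instance on \<open>'n \<times> 'h\<close> is the direct product, so the
  operations of the semidirect product are explicit functions.
\<close>

definition sd_mult :: "('h::group_add \<Rightarrow> 'n::ab_group_add \<Rightarrow> 'n) \<Rightarrow> 'n \<times> 'h \<Rightarrow> 'n \<times> 'h \<Rightarrow> 'n \<times> 'h" where
  "sd_mult \<sigma> \<gamma> \<eta> = (fst \<gamma> + \<sigma> (snd \<gamma>) (fst \<eta>), snd \<gamma> + snd \<eta>)"

definition sd_inv :: "('h::group_add \<Rightarrow> 'n::ab_group_add \<Rightarrow> 'n) \<Rightarrow> 'n \<times> 'h \<Rightarrow> 'n \<times> 'h" where
  "sd_inv \<sigma> \<gamma> = (\<sigma> (- snd \<gamma>) (- fst \<gamma>), - snd \<gamma>)"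

lemma hom_to_Aut_add: "hom_to_Aut \<sigma> \<Longrightarrow> \<sigma> h (m + n) = \<sigma> h m + \<sigma> h n"
  by (simp add: hom_to_Aut_def automorphisms_def)

lemma hom_to_Aut_comp: "hom_to_Aut \<sigma> \<Longrightarrow> \<sigma> (h + l) n = \<sigma> h (\<sigma> l n)"
  by (simp add: hom_to_Aut_def)

lemma hom_to_Aut_zero:
  assumes "hom_to_Aut \<sigma>"
  shows "\<sigma> 0 n = n"
proof -
  have "\<sigma> 0 (\<sigma> 0 n) = \<sigma> 0 n"
    using hom_to_Aut_comp[OF assms, of 0 0 n] by simp
  moreover have "inj (\<sigma> 0)"
    using assms by (simp add: hom_to_Aut_def automorphisms_def bij_is_inj)
  ultimately show ?thesis
    by (simp add: inj_eq)
qed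

lemma sd_mult_assoc:
  assumes "hom_to_Aut \<sigma>"
  shows "sd_mult \<sigma> (sd_mult \<sigma> a b) c = sd_mult \<sigma> a (sd_mult \<sigma> b c)"
  by (simp add: sd_mult_def hom_to_Aut_add[OF assms] hom_to_Aut_comp[OF assms] add.assoc)

lemma sd_mult_one_left:
  assumes "hom_to_Aut \<sigma>"
  shows "sd_mult \<sigma> (0, 0) a = a"
  by (simp add: sd_mult_def hom_to_Aut_zero[OF assms])

lemma sd_mult_inv_left:
  assumes "hom_to_Aut \<sigma>"
  shows "sd_mult \<sigma> (sd_inv \<sigma> a) a = (0, 0)"
proof -
  have "\<sigma> h 0 = 0" for h
    using hom_to_Aut_add[OF assms, of h 0 0] by simp
  then show ?thesis
    by (simp add: sd_mult_def sd_inv_def hom_to_Aut_add[OF assms, symmetric])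
qed

definition left_regular ::
  "('h::group_add \<Rightarrow> 'n::ab_group_add \<Rightarrow> 'n) \<Rightarrow> 'n \<times> 'h \<Rightarrow> ('n \<times> 'h \<Rightarrow> complex) \<Rightarrow> 'n \<times> 'h \<Rightarrow> complex" where
  "left_regular \<sigma> \<gamma> f = (\<lambda>\<eta>. f (sd_mult \<sigma> (sd_inv \<sigma> \<gamma>) \<eta>))"

definition ell1 :: "('a \<Rightarrow> complex) set" where
  "ell1 = {a. (\<lambda>x. cmod (a x)) summable_on UNIV}"

definition ell2 :: "('a \<Rightarrow> complex) set" where
  "ell2 = {a. (\<lambda>x. (cmod (a x))\<^sup>2) summable_on UNIV}"

definition ell2_inner :: "('a \<Rightarrow> complex) \<Rightarrow> ('a \<Rightarrow> complex) \<Rightarrow> complex" where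
  "ell2_inner a b = (\<Sum>\<^sub>\<infinity>x. a x * cnj (b x))"

definition ell2_norm :: "('a \<Rightarrow> complex) \<Rightarrow> real" where
  "ell2_norm a = sqrt (\<Sum>\<^sub>\<infinity>x. (cmod (a x))\<^sup>2)"

definition bessel_bound :: "('i \<Rightarrow> 'a \<Rightarrow> complex) \<Rightarrow> real \<Rightarrow> bool" where
  "bessel_bound X B \<longleftrightarrow> (\<forall>x\<in>ell2.
     (\<lambda>i. (cmod (ell2_inner x (X i)))\<^sup>2) summable_on UNIV \<and>
     (\<Sum>\<^sub>\<infinity>i. (cmod (ell2_inner x (X i)))\<^sup>2) \<le> B * (ell2_norm x)\<^sup>2)"

definition bessel_sequence :: "('i \<Rightarrow> 'a \<Rightarrow> complex) \<Rightarrow> bool" where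
  "bessel_sequence X \<longleftrightarrow> (\<forall>i. X i \<in> ell2) \<and> (\<exists>B>0. bessel_bound X B)"

text \<open>
  The value 0 is admitted here, so that the zero system, for which there is no smallest
  strictly positive bound, has optimal bound 0.
\<close>

definition optimal_bessel_bound :: "('i \<Rightarrow> 'a \<Rightarrow> complex) \<Rightarrow> real \<Rightarrow> bool" where
  "optimal_bessel_bound X B \<longleftrightarrow>
     0 \<le> B \<and> bessel_bound X B \<and> (\<forall>B'\<ge>0. bessel_bound X B' \<longrightarrow> B \<le> B')"

text \<open>
  A character \<open>\<xi>\<close> is the function \<open>n \<mapsto> \<langle>n, \<xi>\<rangle>\<close>. The dual group carries the topology of
  pointwise convergence, that is, the subspace topology of the product topology on functions.
\<close>

definition dual_group :: "('n::ab_group_add \<Rightarrow> complex) set" where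
  "dual_group = {\<xi>. (\<forall>m n. \<xi> (m + n) = \<xi> m * \<xi> n) \<and> (\<forall>n. cmod (\<xi> n) = 1)}"

text \<open>
  Haar measure: an invariant Radon measure on the Borel sets of the dual group. Its total mass
  is 1, which is the normalization making the Fourier transform unitary when \<open>\<ell>\<^sup>2\<close> is taken
  with respect to counting measure (the transform of the indicator of \<open>{0}\<close> is the
  constant 1). As the group may be uncountable, its dual need not be metrizable and regularity
  is not automatic.
\<close>

definition haar_dual :: "('n::ab_group_add \<Rightarrow> complex) measure \<Rightarrow> bool" where
  "haar_dual \<mu> \<longleftrightarrow>
     sets \<mu> = sets (restrict_space borel dual_group) \<and>
     emeasure \<mu> (space \<mu>) = 1 \<and>
     (\<forall>\<xi>\<in>dual_group. \<forall>A\<in>sets \<mu>. emeasure \<mu> ((\<lambda>\<eta> n. \<xi> n * \<eta> n) ` A) = emeasure \<mu> A) \<and>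
     (\<forall>A\<in>sets \<mu>. emeasure \<mu> A = (INF U\<in>{U. open U \<and> A \<subseteq> U}. emeasure \<mu> (U \<inter> dual_group))) \<and>
     (\<forall>U. open U \<longrightarrow> emeasure \<mu> (U \<inter> dual_group) =
        (SUP K\<in>{K. compact K \<and> K \<subseteq> U \<inter> dual_group}. emeasure \<mu> K))"

definition L2_fun :: "'a measure \<Rightarrow> ('a \<Rightarrow> complex) \<Rightarrow> bool" where
  "L2_fun \<mu> g \<longleftrightarrow> g \<in> borel_measurable \<mu> \<and> integrable \<mu> (\<lambda>\<xi>. (cmod (g \<xi>))\<^sup>2)"

definition Linf_fun :: "'a measure \<Rightarrow> ('a \<Rightarrow> complex) \<Rightarrow> bool" where
  "Linf_fun \<mu> g \<longleftrightarrow> g \<in> borel_measurable \<mu> \<and> (\<exists>C. AE \<xi> in \<mu>. cmod (g \<xi>) \<le> C)"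

definition fourier_ell1 :: "('n::ab_group_add \<Rightarrow> complex) \<Rightarrow> ('n \<Rightarrow> complex) \<Rightarrow> complex" where
  "fourier_ell1 a \<xi> = (\<Sum>\<^sub>\<infinity>n. a n * \<xi> (- n))"

text \<open>
  The extension of the Fourier transform by continuity to \<open>\<ell>\<^sup>2\<close>: \<open>g\<close> represents the transform
  of \<open>a\<close> if the transforms of any \<open>\<ell>\<^sup>1\<close> sequences approximating \<open>a\<close> in \<open>\<ell>\<^sup>2\<close> converge to \<open>g\<close>
  in \<open>L\<^sup>2\<close>. Such a \<open>g\<close> is determined up to null sets, and \<open>fourier\<close> picks a representative.
\<close>

definition is_fourier ::
  "('n::ab_group_add \<Rightarrow> complex) measure \<Rightarrow> ('n \<Rightarrow> complex) \<Rightarrow> (('n \<Rightarrow> complex) \<Rightarrow> complex) \<Rightarrow> bool" where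
  "is_fourier \<mu> a g \<longleftrightarrow> L2_fun \<mu> g \<and>
     (\<forall>b :: nat \<Rightarrow> 'n \<Rightarrow> complex.
        (\<forall>k. b k \<in> ell1) \<and> (\<lambda>k. ell2_norm (\<lambda>n. b k n - a n)) \<longlonglongrightarrow> 0 \<longrightarrow>
        (\<lambda>k. \<integral>\<^sup>+\<xi>. ennreal ((cmod (fourier_ell1 (b k) \<xi> - g \<xi>))\<^sup>2) \<partial>\<mu>) \<longlonglongrightarrow> 0)"

definition fourier ::
  "('n::ab_group_add \<Rightarrow> complex) measure \<Rightarrow> ('n \<Rightarrow> complex) \<Rightarrow> ('n \<Rightarrow> complex) \<Rightarrow> complex" where
  "fourier \<mu> a = (SOME g. is_fourier \<mu> a g)"

definition transfer_matrix ::
  "('n::ab_group_add \<Rightarrow> complex) measure \<Rightarrow> ('h::{group_add,finite} \<Rightarrow> 'n \<Rightarrow> 'n) \<Rightarrow>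
   ('n \<times> 'h \<Rightarrow> complex) \<Rightarrow> ('n \<Rightarrow> complex) \<Rightarrow> ((complex, 'h) vec, 'h) vec" where
  "transfer_matrix \<mu> \<sigma> f \<xi> =
     (\<chi> h l. fourier \<mu> (\<lambda>n. f (sd_mult \<sigma> (sd_inv \<sigma> (0, l)) (n, h))) \<xi>)"

definition conj_transpose :: "complex^'m^'n \<Rightarrow> complex^'n^'m" where
  "conj_transpose A = (\<chi> i j. cnj (A $ j $ i))"

definition eigenvalues :: "complex^'n^'n \<Rightarrow> complex set" where
  "eigenvalues A = {z. \<exists>v. v \<noteq> 0 \<and> A *v v = z *s v}"

text \<open>Meant for Hermitian matrices, whose eigenvalues are real.\<close>

definition lambda_max :: "complex^'n^'n \<Rightarrow> real" where
  "lambda_max A = Max (Re ` eigenvalues A)"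

end

theory Submission
  imports Defs "HOL-Probability.Probability_Measure"
begin

text \<open>
  By duality, \<open>B\<close> is a Bessel bound iff \<open>\<parallel>\<Sum> a(\<gamma>) L\<^sub>\<gamma> f\<parallel>\<^sup>2 \<le> B \<parallel>a\<parallel>\<^sup>2\<close> for all finitely supported \<open>a\<close>. Slicing
  \<open>\<Gamma>\<close> along the cosets of \<open>N\<close> and applying Parseval turns this into
  \<open>\<integral> \<parallel>F(\<xi>) A(\<xi>)\<parallel>\<^sup>2 d\<mu> \<le> B \<integral> \<parallel>A(\<xi>)\<parallel>\<^sup>2 d\<mu>\<close> for all vectors \<open>A\<close> of trigonometric polynomials. Squares of real
  trigonometric polynomials approximate indicators of Borel sets boundedly almost everywhere (they
  separate the points of the compact dual, and \<open>\<mu>\<close> is regular), so the inequality localises to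
  \<open>\<parallel>F(\<xi>) v\<parallel>\<^sup>2 \<le> B \<parallel>v\<parallel>\<^sup>2\<close> almost everywhere, first for each \<open>v\<close> in a countable dense set and hence for
  all \<open>v\<close>. The best such \<open>B\<close> is the essential supremum of the squared operator norm of \<open>F(\<xi>)\<close>, which is the
  largest eigenvalue of \<open>F(\<xi>)\<^sup>* F(\<xi>)\<close>. Parseval rests on the orthogonality of characters, i.e. on
  characters of \<open>N\<close> separating points.
\<close>

section \<open>Characters of a discrete abelian group separate points\<close>

text \<open>\<open>N\<close> may be uncountable, so its dual need not be metrizable and
  \<open>ell2\<close> need not be separable. Countability enters only through sequences of
  approximants and through a dense subset of the finite-dimensional coefficient space, which lets
  the null set in the localisation be chosen independently of the vector. The transfer matrix has
  its form because (n,l) = (n,0)(0,l): the factor (n,0) acts on a slice as the plain shift by n,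
  which becomes multiplication by a character, while \<open>\<sigma>\<close> stays inside the slices
  of the (0,l)-translates. Squares of polynomials appear since the test vector q v has squared norm
  q^2 |v|^2. The equivalence between a Bessel bound and an almost everywhere bound is proved for
  each \<open>B\<close> at least 0 separately, so both claims follow without building extremal
  sequences. \<open>fourier\<close> is a choice: nothing is known of it until a transform is shown
  to exist, which takes completeness of L2. As \<open>is_fourier\<close> quantifies over all
  summable approximants, \<open>ell1\<close> has to be treated beside finite supports. Characters
  separate points because the circle is divisible.\<close>

definition nat_mult :: "nat \<Rightarrow> 'a::ab_group_add \<Rightarrow> 'a" where
  "nat_mult k x = (\<Sum>i<k. x)"

lemma nat_mult_0 [simp]: "nat_mult 0 x = 0"
  by (simp add: nat_mult_def)

lemma nat_mult_Suc [simp]: "nat_mult (Suc k) x = nat_mult k x + x"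
  by (simp add: nat_mult_def)

lemma nat_mult_add: "nat_mult (j + k) x = nat_mult j x + nat_mult k x"
  by (induction k) (simp_all add: add.assoc)

lemma nat_mult_mult: "nat_mult (j * k) x = nat_mult j (nat_mult k x)"
  by (induction j) (simp_all add: nat_mult_add add.commute)

text \<open>A character of a subgroup of \<open>N\<close>, encoded by its graph: a subgroup of
  \<open>N\<close> times the circle whose only element over 0 is (0, 1). With graphs, extension is
  inclusion and the upper bound of a chain is its union, as Zorn's lemma wants.\<close>

definition partial_character :: "('n::ab_group_add \<times> complex) set \<Rightarrow> bool" where
  "partial_character R \<longleftrightarrow> (0, 1) \<in> R \<and>
     (\<forall>m w n z. (m, w) \<in> R \<longrightarrow> (n, z) \<in> R \<longrightarrow> (m - n, w / z) \<in> R) \<and>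
     (\<forall>m w. (m, w) \<in> R \<longrightarrow> cmod w = 1) \<and> (\<forall>w. (0, w) \<in> R \<longrightarrow> w = 1)"

lemma partial_characterD:
  assumes "partial_character R"
  shows partial_character_zero: "(0, 1) \<in> R"
    and partial_character_diff: "(m, w) \<in> R \<Longrightarrow> (n, z) \<in> R \<Longrightarrow> (m - n, w / z) \<in> R"
    and partial_character_norm: "(m, w) \<in> R \<Longrightarrow> cmod w = 1"
    and partial_character_one: "(0, w) \<in> R \<Longrightarrow> w = 1"
  using assms unfolding partial_character_def by blast+

lemma partial_character_minus:
  assumes "partial_character R" "(m, w) \<in> R"
  shows "(- m, inverse w) \<in> R"
  using partial_character_diff[OF assms(1) partial_character_zero[OF assms(1)] assms(2)]
  by (simp add: divide_inverse)

lemma partial_character_add: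
  assumes "partial_character R" "(m, w) \<in> R" "(n, z) \<in> R"
  shows "(m + n, w * z) \<in> R"
  using partial_character_diff[OF assms(1,2) partial_character_minus[OF assms(1,3)]]
  by (simp add: divide_inverse)

lemma partial_character_unique:
  assumes "partial_character R" "(m, w) \<in> R" "(m, z) \<in> R"
  shows "w = z"
proof -
  have "w / z = 1"
    using partial_character_diff[OF assms] by (intro partial_character_one[OF assms(1)]) simp
  moreover have "z \<noteq> 0"
    using partial_character_norm[OF assms(1,3)] by auto
  ultimately show ?thesis by (metis divide_eq_1_iff)
qed

lemma partial_character_nat_mult:
  assumes "partial_character R" "(m, w) \<in> R"
  shows "(nat_mult k m, w ^ k) \<in> R"
proof (induction k)
  case 0
  show ?case using partial_character_zero[OF assms(1)] by simp
next
  case (Suc k)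
  then show ?case using partial_character_add[OF assms(1) Suc assms(2)] by (simp add: mult.commute)
qed

text \<open>Divisibility of the circle. If no positive multiple of \<open>x\<close> lies in the
  domain, every value is compatible, and -1 is taken. Otherwise the least such multiple, d x, has a
  prescribed value c, and any d-th root of c is compatible. Since \<open>x\<close> is outside the
  domain, d is at least 2, so some root differs from 1; this is what later separates
  \<open>x\<close> from 0.\<close>

lemma partial_character_extension_value:
  assumes R: "partial_character R" and x: "x \<notin> Domain R"
  obtains z where "cmod z = 1" "z \<noteq> 1" "\<And>k w. (nat_mult k x, w) \<in> R \<Longrightarrow> w = z ^ k"
proof (cases "\<exists>k>0. nat_mult k x \<in> Domain R")
  case False
  show thesis
  proof (rule that[of "-1"])
    fix k w assume kw: "(nat_mult k x, w) \<in> R"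
    then have "k = 0" using False by auto
    then show "w = (-1) ^ k" using kw partial_character_one[OF R] by simp
  qed auto
next
  case True
  define d where "d = (LEAST k. k > 0 \<and> nat_mult k x \<in> Domain R)"
  have d: "d > 0" "nat_mult d x \<in> Domain R"
    using LeastI_ex[OF True] by (auto simp: d_def)
  have d_le: "d \<le> k" if "k > 0" "nat_mult k x \<in> Domain R" for k
    unfolding d_def using that by (intro Least_le) auto
  have "d \<noteq> 1" using d(2) x by auto
  with d have d2: "d \<ge> 2" by simp
  obtain c where c: "(nat_mult d x, c) \<in> R" using d(2) by blast
  have c1: "cmod c = 1" using partial_character_norm[OF R c] .
  \<comment> \<open>For c = 1 a primitive d-th root of unity serves; for any other c no d-th root
    can be 1.\<close>
  obtain z where z: "z ^ d = c" "z \<noteq> 1"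
  proof (cases "c = 1")
    case True
    let ?z = "cis (2 * pi / d)"
    have "?z ^ d = cis (real d * (2 * pi / d))" by (rule Complex.DeMoivre)
    then have "?z ^ d = 1" using d(1) by simp
    moreover have "?z \<noteq> 1"
    proof
      assume "?z = 1"
      then have "cos (2 * pi / d) = 1" by (auto simp: complex_eq_iff)
      then obtain n :: int where n: "2 * pi / d = n * 2 * pi"
        using cos_one_2pi_int by auto
      then have "1 / real d = n" using d by (simp add: field_simps)
      moreover have "0 < 1 / real d" "1 / real d < 1" using d2 by auto
      ultimately have "0 < n" "n < 1" by (metis of_int_0_less_iff, metis of_int_less_1_iff)
      then show False by simp
    qed
    ultimately show thesis using that True by simp
  next
    case False
    define z where "z = cis (Arg c / d)"
    have "z ^ d = cis (Arg c)" using d by (simp add: z_def Complex.DeMoivre)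
    also have "\<dots> = c" using c1 cis_Arg[of c] by (cases "c = 0") (auto simp: sgn_div_norm)
    finally have "z ^ d = c" .
    moreover from this have "z \<noteq> 1" using False by auto
    ultimately show thesis by (rule that)
  qed
  have "cmod z ^ d = 1 ^ d" using z(1) c1 by (metis norm_power power_one)
  then have z1: "cmod z = 1" using d(1) by (simp only: power_eq_iff_eq_base[OF d(1)] norm_ge_zero zero_le_one)
  show thesis
  proof (rule that[OF z1 z(2)])
    fix k w assume kw: "(nat_mult k x, w) \<in> R"
    \<comment> \<open>The remainder multiple of \<open>x\<close> also lies in the domain, so
      minimality of d makes the remainder 0.\<close>
    let ?q = "k div d" and ?r = "k mod d"
    have "nat_mult k x = nat_mult ?q (nat_mult d x) + nat_mult ?r x"
      by (simp flip: nat_mult_mult nat_mult_add)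
    moreover have q: "(nat_mult ?q (nat_mult d x), c ^ ?q) \<in> R"
      by (rule partial_character_nat_mult[OF R c])
    ultimately have "(nat_mult ?r x, w / c ^ ?q) \<in> R"
      using partial_character_diff[OF R kw q] by simp
    then have "?r = 0"
      using d_le[of ?r] d(1) by (metis Domain.DomainI linorder_not_le mod_less_divisor neq0_conv)
    then have "k = ?q * d" by (simp add: mod_0_imp_dvd)
    then have "(nat_mult k x, c ^ ?q) \<in> R" using q by (metis nat_mult_mult)
    then have "w = c ^ ?q" using partial_character_unique[OF R kw] by simp
    also have "\<dots> = z ^ k" using \<open>k = ?q * d\<close> z(1) by (metis mult.commute power_mult)
    finally show "w = z ^ k" .
  qed
qed

text \<open>Adjoin (x, z) and take the generated subgroup. Integer multiples are written as
  differences of two natural ones, hence the pair j, k. What needs proof is that nothing but 1 lies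
  over 0, and this is exactly the compatibility of z.\<close>

lemma partial_character_extend:
  assumes R: "partial_character R" and x: "x \<notin> Domain R"
  obtains R' z where "partial_character R'" "R \<subseteq> R'" "(x, z) \<in> R'" "z \<noteq> 1"
proof -
  obtain z where z: "cmod z = 1" "z \<noteq> 1" "\<And>k w. (nat_mult k x, w) \<in> R \<Longrightarrow> w = z ^ k"
    using partial_character_extension_value[OF R x] by blast
  have z0: "z \<noteq> 0" using z(1) by auto
  define R' where "R' = {(m + nat_mult j x - nat_mult k x, w * z ^ j / z ^ k) | m w j k. (m, w) \<in> R}"
  have R'I: "(m + nat_mult j x - nat_mult k x, w * z ^ j / z ^ k) \<in> R'" if "(m, w) \<in> R" for m w j k
    using that by (auto simp: R'_def)
  \<comment> \<open>Only the difference of j and k matters; depending on its sign, \<open>R\<close>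
    contains a multiple of x over w or over the inverse of w.\<close>
  have one: "w * z ^ j / z ^ k = 1" if mw: "(m, w) \<in> R" and eq: "m + nat_mult j x - nat_mult k x = 0" for m w j k
  proof (cases "j \<le> k")
    case True
    then obtain i where i: "k = j + i" using le_Suc_ex by blast
    then have "(nat_mult i x, w) \<in> R" using eq mw by (simp add: nat_mult_add)
    then have "w = z ^ i" by (rule z(3))
    then show ?thesis using z0 i by (simp add: power_add)
  next
    case False
    then obtain i where i: "j = k + i" using le_Suc_ex by (metis nat_le_linear)
    then have "m = - nat_mult i x" using eq by (simp add: nat_mult_add eq_neg_iff_add_eq_0)
    then have "(nat_mult i x, inverse w) \<in> R" using partial_character_minus[OF R mw] by simp
    then have "inverse w = z ^ i" by (rule z(3))
    moreover have "w \<noteq> 0" using partial_character_norm[OF R mw] by auto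
    ultimately have "w * z ^ i = 1" by (metis right_inverse)
    then show ?thesis using z0 i by (simp add: power_add)
  qed
  have "partial_character R'"
    unfolding partial_character_def
  proof (intro conjI allI impI)
    show "(0, 1) \<in> R'" using R'I[OF partial_character_zero[OF R], of 0 0] by simp
  next
    fix m w n u assume "(m, w) \<in> R'" "(n, u) \<in> R'"
    then obtain m1 w1 j1 k1 n1 u1 j2 k2 where
      1: "(m1, w1) \<in> R" "m = m1 + nat_mult j1 x - nat_mult k1 x" "w = w1 * z ^ j1 / z ^ k1" and
      2: "(n1, u1) \<in> R" "n = n1 + nat_mult j2 x - nat_mult k2 x" "u = u1 * z ^ j2 / z ^ k2"
      unfolding R'_def by blast
    have "m - n = (m1 - n1) + nat_mult (j1 + k2) x - nat_mult (k1 + j2) x"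
      using 1 2 by (simp add: nat_mult_add)
    moreover have "w / u = (w1 / u1) * z ^ (j1 + k2) / z ^ (k1 + j2)"
      unfolding 1(3) 2(3) by (simp add: power_add mult.assoc mult.left_commute)
    ultimately show "(m - n, w / u) \<in> R'"
      using R'I[OF partial_character_diff[OF R 1(1) 2(1)]] by simp
  next
    fix m w assume "(m, w) \<in> R'"
    then show "cmod w = 1"
      using z(1) partial_character_norm[OF R]
      by (auto simp: R'_def norm_divide norm_mult norm_power)
  next
    fix w assume "(0, w) \<in> R'"
    then obtain m w' j k where "(m, w') \<in> R" "m + nat_mult j x - nat_mult k x = 0" "w = w' * z ^ j / z ^ k"
      unfolding R'_def by auto
    then show "w = 1" using one by simp
  qed
  moreover have "R \<subseteq> R'" using R'I[of _ _ 0 0] by auto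
  moreover have "(x, z) \<in> R'"
    using R'I[OF partial_character_zero[OF R], of 1 0] by simp
  ultimately show thesis using that z(2) by blast
qed

text \<open>A maximal partial character has full domain, since otherwise the one-step extension
  would enlarge it.\<close>

lemma partial_character_total:
  assumes R: "partial_character R"
  obtains \<xi> where "\<xi> \<in> dual_group" "\<And>m w. (m, w) \<in> R \<Longrightarrow> \<xi> m = w"
proof -
  define P where "P = {R'. partial_character R' \<and> R \<subseteq> R'}"
  have "\<exists>M\<in>P. \<forall>X\<in>P. M \<subseteq> X \<longrightarrow> X = M"
  proof (rule subset_Zorn_nonempty)
    show "P \<noteq> {}" using R by (auto simp: P_def)
  next
    fix C assume C: "C \<noteq> {}" "subset.chain P C"
    have mem: "partial_character X" "R \<subseteq> X" if "X \<in> C" for X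
      using C(2) that by (auto simp: subset.chain_def P_def)
    have both: "\<exists>X\<in>C. p \<in> X \<and> q \<in> X" if "p \<in> \<Union>C" "q \<in> \<Union>C" for p q
    proof -
      from that obtain X Y where XY: "X \<in> C" "p \<in> X" "Y \<in> C" "q \<in> Y" by blast
      then have "X \<subseteq> Y \<or> Y \<subseteq> X"
        using C(2) unfolding subset.chain_def by blast
      with XY show ?thesis by blast
    qed
    have "partial_character (\<Union>C)"
      unfolding partial_character_def
    proof (intro conjI allI impI)
      show "(0, 1) \<in> \<Union>C" using C(1) mem partial_character_zero by fast
    next
      fix m w n z assume "(m, w) \<in> \<Union>C" "(n, z) \<in> \<Union>C"
      then show "(m - n, w / z) \<in> \<Union>C"
        using both mem(1) partial_character_diff by (metis UnionI)
    next
      fix m w assume "(m, w) \<in> \<Union>C"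
      then show "cmod w = 1" using mem(1) partial_character_norm by blast
    next
      fix w assume "(0, w) \<in> \<Union>C"
      then show "w = 1" using mem(1) partial_character_one by blast
    qed
    moreover have "R \<subseteq> \<Union>C" using C(1) mem(2) by blast
    ultimately show "\<Union>C \<in> P" by (simp add: P_def)
  qed
  then obtain M where M: "partial_character M" "R \<subseteq> M" "\<And>X. X \<in> P \<Longrightarrow> M \<subseteq> X \<Longrightarrow> X = M"
    by (auto simp: P_def)
  have dom: "x \<in> Domain M" for x
  proof (rule ccontr)
    assume x: "x \<notin> Domain M"
    then obtain R' z where R': "partial_character R'" "M \<subseteq> R'" "(x, z) \<in> R'"
      using partial_character_extend[OF M(1)] by metis
    then have "R' = M" using M by (auto simp: P_def)
    with R'(3) x show False by blast
  qed
  define \<xi> where "\<xi> m = (SOME w. (m, w) \<in> M)" for m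
  have \<xi>: "(m, \<xi> m) \<in> M" for m
  proof -
    have "\<exists>w. (m, w) \<in> M" using dom[of m] by (simp add: Domain_iff)
    then show ?thesis unfolding \<xi>_def by (rule someI_ex)
  qed
  show thesis
  proof (rule that[of \<xi>])
    show "\<xi> \<in> dual_group"
      unfolding dual_group_def
    proof (intro CollectI conjI allI)
      show "\<xi> (m + n) = \<xi> m * \<xi> n" for m n
        by (rule partial_character_unique[OF M(1) \<xi> partial_character_add[OF M(1) \<xi> \<xi>]])
      show "cmod (\<xi> n) = 1" for n
        by (rule partial_character_norm[OF M(1) \<xi>])
    qed
  next
    fix m w assume "(m, w) \<in> R"
    then have "(m, w) \<in> M" using M(2) by blast
    then show "\<xi> m = w" by (rule partial_character_unique[OF M(1) \<xi>])
  qed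
qed

lemma dual_group_separates_zero:
  fixes x :: "'n::ab_group_add"
  assumes "x \<noteq> 0"
  obtains \<xi> where "\<xi> \<in> dual_group" "\<xi> x \<noteq> 1"
proof -
  have "partial_character {(0::'n, 1)}"
    by (auto simp: partial_character_def)
  moreover have "x \<notin> Domain {(0, 1)}" using assms by auto
  ultimately obtain R z where R: "partial_character R" "(x, z) \<in> R" "z \<noteq> 1"
    using partial_character_extend by metis
  obtain \<xi> where "\<xi> \<in> dual_group" "\<And>m w. (m, w) \<in> R \<Longrightarrow> \<xi> m = w"
    using partial_character_total[OF R(1)] by blast
  with R that show thesis by metis
qed

section \<open>Gram matrices\<close>

lemma inner_complex_mult_left:
  fixes a v w :: complex
  shows "inner (a * v) w = inner v (cnj a * w)"
  by (simp add: inner_complex_def algebra_simps)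

text \<open>\<open>inner\<close> on complex vectors is the real part of the Hermitian product; the
  conjugate transpose is still the adjoint for it, so real Euclidean geometry suffices throughout
  this section.\<close>

lemma inner_matrix_vector_mult:
  fixes A :: "complex^'n^'m"
  shows "inner (A *v v) w = inner v (conj_transpose A *v w)"
proof -
  have "inner (A *v v) w = (\<Sum>i\<in>UNIV. \<Sum>j\<in>UNIV. inner (A $ i $ j * v $ j) (w $ i))"
    by (simp add: inner_vec_def matrix_vector_mult_def inner_sum_left)
  also have "\<dots> = (\<Sum>j\<in>UNIV. \<Sum>i\<in>UNIV. inner (v $ j) (cnj (A $ i $ j) * w $ i))"
    by (subst sum.swap) (simp only: inner_complex_mult_left)
  also have "\<dots> = inner v (conj_transpose A *v w)"
    by (simp add: inner_vec_def matrix_vector_mult_def inner_sum_right conj_transpose_def)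
  finally show ?thesis .
qed

lemma inner_gram:
  fixes A :: "complex^'n^'m"
  shows "inner ((conj_transpose A ** A) *v v) w = inner (A *v v) (A *v w)"
  by (metis inner_commute inner_matrix_vector_mult matrix_vector_mul_assoc)

lemma inner_scalar_same:
  fixes v w :: "complex^'n"
  assumes "Im z = 0"
  shows "inner (z *s v) w = Re z * inner v w"
proof -
  have "inner (z * a) b = Re z * inner a b" for a b :: complex
    using assms by (simp add: inner_complex_def algebra_simps)
  then show ?thesis by (simp add: inner_vec_def sum_distrib_left)
qed

text \<open>\<open>inner\<close> sees real parts only, so the imaginary part of z is extracted by
  pairing z v with i v. The result vanishes because A v and i A v are orthogonal as real
  vectors.\<close>

lemma gram_eigenvalue_real:
  fixes A :: "complex^'n^'m"
  assumes "z \<in> eigenvalues (conj_transpose A ** A)"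
  shows "Im z = 0"
proof -
  obtain v where v: "v \<noteq> 0" "(conj_transpose A ** A) *v v = z *s v"
    using assms by (auto simp: eigenvalues_def)
  have "inner (z * a) (\<i> * a) = Im z * inner a a" for a :: complex
    by (simp add: inner_complex_def algebra_simps)
  then have "Im z * inner v v = inner (z *s v) (\<i> *s v)"
    by (simp add: inner_vec_def sum_distrib_left)
  also have "\<dots> = inner (A *v v) (A *v (\<i> *s v))"
    by (metis v(2) inner_gram)
  also have "\<dots> = inner (A *v v) (\<i> *s (A *v v))"
    by (simp add: vector_scalar_commute)
  also have "\<dots> = 0"
    by (simp add: inner_vec_def inner_complex_def)
  finally show ?thesis using v(1) by simp
qed

text \<open>Eigenvectors of different eigenvalues are orthogonal, and a pairwise orthogonal family
  in a Euclidean space is finite. Without finiteness the \<open>Max\<close> in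
  \<open>lambda_max\<close> would be meaningless.\<close>

lemma finite_gram_eigenvalues:
  fixes A :: "complex^'n^'n"
  shows "finite (eigenvalues (conj_transpose A ** A))"
proof -
  let ?E = "eigenvalues (conj_transpose A ** A)"
  have "\<forall>z\<in>?E. \<exists>v. v \<noteq> 0 \<and> (conj_transpose A ** A) *v v = z *s v"
    by (auto simp: eigenvalues_def)
  then obtain v where v: "\<And>z. z \<in> ?E \<Longrightarrow> v z \<noteq> 0"
    "\<And>z. z \<in> ?E \<Longrightarrow> (conj_transpose A ** A) *v v z = z *s v z"
    by metis
  have orth: "inner (v y) (v z) = 0" if yz: "y \<in> ?E" "z \<in> ?E" "y \<noteq> z" for y z
  proof -
    have "Re y * inner (v y) (v z) = inner (A *v v y) (A *v v z)"
      by (metis v(2) yz(1) inner_gram inner_scalar_same gram_eigenvalue_real)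
    also have "\<dots> = Re z * inner (v y) (v z)"
      by (metis v(2) yz(2) inner_commute inner_gram inner_scalar_same gram_eigenvalue_real)
    finally show ?thesis
      using yz gram_eigenvalue_real[OF yz(1)] gram_eigenvalue_real[OF yz(2)]
      by (auto simp: complex_eq_iff)
  qed
  have "inj_on v ?E"
    using orth v(1) by (metis inj_onI inner_eq_zero_iff)
  moreover have "finite (v ` ?E)"
    using orth by (intro pairwise_orthogonal_imp_finite) (auto simp: pairwise_def orthogonal_def)
  ultimately show ?thesis by (rule finite_imageD[rotated])
qed

text \<open>By compactness the norm is attained at a unit vector u. The form M^2 |v|^2 - |A v|^2 is
  nonnegative and vanishes at u, so its first variation there is zero, which says that u is an
  eigenvector for M^2. No eigenvalue can exceed M^2.\<close>

lemma lambda_max_gram: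
  fixes A :: "complex^'n^'n"
  shows "lambda_max (conj_transpose A ** A) = (onorm ((*v) A))\<^sup>2"
proof -
  let ?G = "conj_transpose A ** A"
  have lin: "bounded_linear ((*v) A)" by simp
  note L = bounded_linear.linear[OF lin]
  have "compact (sphere (0 :: complex^'n) 1)" "sphere (0 :: complex^'n) 1 \<noteq> {}"
    by auto
  moreover have "continuous_on (sphere 0 1) (\<lambda>v. norm (A *v v))"
    by (intro continuous_on_norm linear_continuous_on lin)
  ultimately obtain u where u: "norm u = 1" "\<And>v. norm v = 1 \<Longrightarrow> norm (A *v v) \<le> norm (A *v u)"
    using continuous_attains_sup[of "sphere (0 :: complex^'n) 1" "\<lambda>v. norm (A *v v)"] by auto
  define M where "M = norm (A *v u)"
  have bound: "norm (A *v v) \<le> M * norm v" for v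
  proof (cases "v = 0")
    case False
    have "norm (A *v (v /\<^sub>R norm v)) \<le> M"
      using False unfolding M_def by (intro u(2)) simp
    then show ?thesis
      using False by (simp add: linear_scale[OF L] field_simps)
  qed simp
  have "onorm ((*v) A) = M"
  proof (rule antisym)
    show "onorm ((*v) A) \<le> M" by (rule onorm_le) (rule bound)
    show "M \<le> onorm ((*v) A)" using onorm[OF lin, of u] u(1) by (simp add: M_def)
  qed
  have max: "Re z \<le> M\<^sup>2" if z: "z \<in> eigenvalues ?G" for z
  proof -
    obtain v where v: "v \<noteq> 0" "?G *v v = z *s v"
      using z by (auto simp: eigenvalues_def)
    have "Re z * inner v v = inner (A *v v) (A *v v)"
      by (metis v(2) inner_gram inner_scalar_same gram_eigenvalue_real z)
    also have "\<dots> \<le> (M * norm v)\<^sup>2"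
      using power_mono[OF bound[of v] norm_ge_zero, of 2] by (simp add: power2_norm_eq_inner)
    also have "\<dots> = M\<^sup>2 * inner v v"
      by (simp add: power_mult_distrib power2_norm_eq_inner)
    finally show ?thesis using v(1) by simp
  qed
  have "inner (?G *v u - M\<^sup>2 *\<^sub>R u) w = 0" for w
  proof -
    define c where "c = inner (A *v u) (A *v w) - M\<^sup>2 * inner u w"
    define d where "d = M\<^sup>2 * inner w w - inner (A *v w) (A *v w)"
    \<comment> \<open>Nonnegativity of the form at u + t w; the constant terms cancel because |A u|
      = M and |u| = 1.\<close>
    have quad: "2 * t * c \<le> t\<^sup>2 * d" for t
    proof -
      have "(norm (A *v (u + t *\<^sub>R w)))\<^sup>2 \<le> (M * norm (u + t *\<^sub>R w))\<^sup>2"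
        by (intro power_mono bound) simp
      moreover have "A *v (u + t *\<^sub>R w) = A *v u + t *\<^sub>R (A *v w)"
        by (simp add: linear_add[OF L] linear_scale[OF L])
      ultimately have "inner (A *v u + t *\<^sub>R (A *v w)) (A *v u + t *\<^sub>R (A *v w))
          \<le> M\<^sup>2 * inner (u + t *\<^sub>R w) (u + t *\<^sub>R w)"
        by (metis power_mult_distrib power2_norm_eq_inner)
      moreover have "inner (A *v u) (A *v u) = M\<^sup>2" "inner u u = 1"
        using u(1) by (simp_all add: M_def power2_norm_eq_inner norm_eq_1)
      ultimately show ?thesis
        by (simp add: c_def d_def inner_add_left inner_add_right inner_commute[of w u]
            inner_commute[of "A *v w" "A *v u"] algebra_simps power2_eq_square)
    qed
    have "c = 0"
    proof (rule ccontr)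
      assume "c \<noteq> 0"
      \<comment> \<open>A positive number above d: the test value t = c / D turns the inequality
        into 2 c^2 \<le> c^2.\<close>
      define D where "D = \<bar>d\<bar> + 1"
      have D: "D > 0" "d < D" by (auto simp: D_def)
      have "2 * (c / D) * c \<le> (c / D)\<^sup>2 * d" by (rule quad)
      also have "\<dots> \<le> (c / D)\<^sup>2 * D" using D by (intro mult_left_mono) auto
      finally have "2 * c\<^sup>2 \<le> c\<^sup>2" using D by (simp add: field_simps power2_eq_square)
      then show False using \<open>c \<noteq> 0\<close> by simp
    qed
    then show ?thesis by (simp add: c_def inner_diff_left inner_gram)
  qed
  then have "?G *v u - M\<^sup>2 *\<^sub>R u = 0" by (metis inner_eq_zero_iff)
  then have "?G *v u = complex_of_real (M\<^sup>2) *s u"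
    by (simp add: vec_eq_iff scaleR_conv_of_real[where 'a=complex])
  then have "complex_of_real (M\<^sup>2) \<in> eigenvalues ?G"
    using u(1) unfolding eigenvalues_def by (intro CollectI exI[of _ u]) auto
  then have "Re (complex_of_real (M\<^sup>2)) \<in> Re ` eigenvalues ?G" by (rule imageI)
  then have "Max (Re ` eigenvalues ?G) = M\<^sup>2"
    using max by (intro Max_eqI finite_imageI finite_gram_eigenvalues) auto
  then show ?thesis by (simp add: lambda_max_def \<open>onorm ((*v) A) = M\<close>)
qed

section \<open>Square-integrable functions\<close>

text \<open>The squared L2 norm, on functions rather than on classes modulo null sets. Keeping
  squares replaces the triangle inequality by versions with constants 2, or 1 + e and 1 + 1/e. A
  non-integrable square gives the default value 0, so membership in L2 is always carried
  along.\<close>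

definition sq_integral :: "'a measure \<Rightarrow> ('a \<Rightarrow> complex) \<Rightarrow> real" where
  "sq_integral M u = (\<integral>x. (cmod (u x))\<^sup>2 \<partial>M)"

lemma sq_integral_nonneg [simp]: "0 \<le> sq_integral M u"
  by (simp add: sq_integral_def)

lemma L2_fun_measurable: "L2_fun M u \<Longrightarrow> u \<in> borel_measurable M"
  by (simp add: L2_fun_def)

lemma L2_fun_integrable: "L2_fun M u \<Longrightarrow> integrable M (\<lambda>x. (cmod (u x))\<^sup>2)"
  by (simp add: L2_fun_def)

lemma nn_integral_sq_eq: "L2_fun M u \<Longrightarrow> (\<integral>\<^sup>+x. ennreal ((cmod (u x))\<^sup>2) \<partial>M) = ennreal (sq_integral M u)"
  unfolding sq_integral_def by (intro nn_integral_eq_integral L2_fun_integrable) auto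

lemma
  assumes u: "u \<in> borel_measurable M" and v: "L2_fun M v" and w: "L2_fun M w"
    and le: "AE x in M. (cmod (u x))\<^sup>2 \<le> a * (cmod (v x))\<^sup>2 + b * (cmod (w x))\<^sup>2"
  shows L2_fun_bounded: "L2_fun M u"
    and sq_integral_bounded: "sq_integral M u \<le> a * sq_integral M v + b * sq_integral M w"
proof -
  have int: "integrable M (\<lambda>x. a * (cmod (v x))\<^sup>2 + b * (cmod (w x))\<^sup>2)"
    using L2_fun_integrable[OF v] L2_fun_integrable[OF w] by simp
  have "integrable M (\<lambda>x. (cmod (u x))\<^sup>2)"
    by (rule Bochner_Integration.integrable_bound[OF int]) (use u le in auto)
  then show L2: "L2_fun M u" using u by (simp add: L2_fun_def)
  have "sq_integral M u \<le> (\<integral>x. a * (cmod (v x))\<^sup>2 + b * (cmod (w x))\<^sup>2 \<partial>M)"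
    unfolding sq_integral_def by (intro integral_mono_AE L2_fun_integrable L2 int le)
  also have "\<dots> = a * sq_integral M v + b * sq_integral M w"
    using L2_fun_integrable[OF v] L2_fun_integrable[OF w] by (simp add: sq_integral_def)
  finally show "sq_integral M u \<le> a * sq_integral M v + b * sq_integral M w" .
qed

lemma cmod_add_sq_le: "(cmod (a + b))\<^sup>2 \<le> 2 * (cmod a)\<^sup>2 + 2 * (cmod b)\<^sup>2"
proof -
  have "(cmod (a + b))\<^sup>2 \<le> (cmod a + cmod b)\<^sup>2"
    by (intro power_mono norm_triangle_ineq) simp
  also have "\<dots> \<le> 2 * (cmod a)\<^sup>2 + 2 * (cmod b)\<^sup>2"
    using zero_le_power2[of "cmod a - cmod b"] by (simp add: power2_eq_square algebra_simps)
  finally show ?thesis .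
qed

lemma
  assumes "L2_fun M u" "L2_fun M v"
  shows L2_fun_add: "L2_fun M (\<lambda>x. u x + v x)"
    and sq_integral_add_le: "sq_integral M (\<lambda>x. u x + v x) \<le> 2 * sq_integral M u + 2 * sq_integral M v"
proof -
  have [measurable]: "u \<in> borel_measurable M" "v \<in> borel_measurable M"
    using assms by (auto dest: L2_fun_measurable)
  have "(\<lambda>x. u x + v x) \<in> borel_measurable M" by measurable
  from L2_fun_bounded[OF this assms, of 2 2] sq_integral_bounded[OF this assms, of 2 2]
  show "L2_fun M (\<lambda>x. u x + v x)" "sq_integral M (\<lambda>x. u x + v x) \<le> 2 * sq_integral M u + 2 * sq_integral M v"
    by (simp_all add: cmod_add_sq_le)
qed

lemma
  assumes "L2_fun M u" "h \<in> borel_measurable M" "AE x in M. cmod (h x) \<le> C"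
  shows L2_fun_mult_bounded: "L2_fun M (\<lambda>x. h x * u x)"
    and sq_integral_mult_le: "sq_integral M (\<lambda>x. h x * u x) \<le> C\<^sup>2 * sq_integral M u"
proof -
  have m: "(\<lambda>x. h x * u x) \<in> borel_measurable M"
    using assms(2) L2_fun_measurable[OF assms(1)] by simp
  have "AE x in M. (cmod (h x * u x))\<^sup>2 \<le> C\<^sup>2 * (cmod (u x))\<^sup>2 + 0 * (cmod (u x))\<^sup>2"
    using assms(3)
  proof eventually_elim
    fix x assume "cmod (h x) \<le> C"
    then show "(cmod (h x * u x))\<^sup>2 \<le> C\<^sup>2 * (cmod (u x))\<^sup>2 + 0 * (cmod (u x))\<^sup>2"
      by (simp add: norm_mult power_mult_distrib mult_right_mono power_mono)
  qed
  from L2_fun_bounded[OF m assms(1,1) this] sq_integral_bounded[OF m assms(1,1) this]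
  show "L2_fun M (\<lambda>x. h x * u x)" "sq_integral M (\<lambda>x. h x * u x) \<le> C\<^sup>2 * sq_integral M u"
    by simp_all
qed

lemma L2_fun_cmult: "L2_fun M u \<Longrightarrow> L2_fun M (\<lambda>x. c * u x)"
  by (rule L2_fun_mult_bounded[where C = "cmod c"]) auto

lemma sq_integral_diff_commute: "sq_integral M (\<lambda>x. u x - v x) = sq_integral M (\<lambda>x. v x - u x)"
  by (simp add: sq_integral_def norm_minus_commute)

lemma L2_fun_diff:
  assumes "L2_fun M u" "L2_fun M v"
  shows "L2_fun M (\<lambda>x. u x - v x)"
  using L2_fun_add[OF assms(1) L2_fun_cmult[OF assms(2), of "-1"]] by simp

lemma L2_fun_zero: "L2_fun M (\<lambda>_. 0)"
  by (simp add: L2_fun_def)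

lemma L2_fun_sum: "(\<And>i. i \<in> I \<Longrightarrow> L2_fun M (u i)) \<Longrightarrow> L2_fun M (\<lambda>x. \<Sum>i\<in>I. u i x)"
  by (induction I rule: infinite_finite_induct) (auto intro: L2_fun_add L2_fun_zero)

lemma sq_integral_triangle:
  assumes "L2_fun M u" "L2_fun M v" "L2_fun M w"
  shows "sq_integral M (\<lambda>x. u x - w x) \<le> 2 * sq_integral M (\<lambda>x. u x - v x) + 2 * sq_integral M (\<lambda>x. v x - w x)"
  using sq_integral_add_le[OF L2_fun_diff[OF assms(1,2)] L2_fun_diff[OF assms(2,3)]] by simp

text \<open>Membership is part of the notion: for differences outside L2, \<open>sq_integral\<close>
  could be 0 by default and the limit would say nothing.\<close>

definition L2_tendsto :: "'a measure \<Rightarrow> (nat \<Rightarrow> 'a \<Rightarrow> complex) \<Rightarrow> ('a \<Rightarrow> complex) \<Rightarrow> bool" where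
  "L2_tendsto M u v \<longleftrightarrow> (\<forall>k. L2_fun M (u k)) \<and> L2_fun M v \<and> (\<lambda>k. sq_integral M (\<lambda>x. u k x - v x)) \<longlonglongrightarrow> 0"

lemma L2_tendstoD:
  assumes "L2_tendsto M u v"
  shows L2_tendsto_fun: "L2_fun M (u k)" and L2_tendsto_limit: "L2_fun M v"
    and L2_tendsto_lim: "(\<lambda>k. sq_integral M (\<lambda>x. u k x - v x)) \<longlonglongrightarrow> 0"
  using assms by (auto simp: L2_tendsto_def)

lemma L2_tendstoI:
  assumes "\<And>k. L2_fun M (u k)" "L2_fun M v" "\<And>k. sq_integral M (\<lambda>x. u k x - v x) \<le> e k" "e \<longlonglongrightarrow> 0"
  shows "L2_tendsto M u v"
  unfolding L2_tendsto_def using assms(1,2)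
  by (auto intro!: tendsto_sandwich[OF _ _ tendsto_const assms(4)] simp: assms(3))

lemma L2_tendsto_add:
  assumes "L2_tendsto M u u'" "L2_tendsto M v v'"
  shows "L2_tendsto M (\<lambda>k x. u k x + v k x) (\<lambda>x. u' x + v' x)"
proof (rule L2_tendstoI)
  note u = L2_tendstoD[OF assms(1)] and v = L2_tendstoD[OF assms(2)]
  show "L2_fun M (\<lambda>x. u k x + v k x)" for k by (intro L2_fun_add u v)
  show "L2_fun M (\<lambda>x. u' x + v' x)" by (intro L2_fun_add u v)
  show "sq_integral M (\<lambda>x. u k x + v k x - (u' x + v' x))
      \<le> 2 * sq_integral M (\<lambda>x. u k x - u' x) + 2 * sq_integral M (\<lambda>x. v k x - v' x)" for k
    using sq_integral_add_le[OF L2_fun_diff[OF u(1,2)] L2_fun_diff[OF v(1,2)]]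
    by (simp add: algebra_simps)
  show "(\<lambda>k. 2 * sq_integral M (\<lambda>x. u k x - u' x) + 2 * sq_integral M (\<lambda>x. v k x - v' x)) \<longlonglongrightarrow> 0"
    using tendsto_add[OF tendsto_mult_right_zero[OF u(3), of 2] tendsto_mult_right_zero[OF v(3), of 2]] by simp
qed

lemma L2_tendsto_mult_bounded:
  assumes "L2_tendsto M u v" "h \<in> borel_measurable M" "AE x in M. cmod (h x) \<le> C"
  shows "L2_tendsto M (\<lambda>k x. h x * u k x) (\<lambda>x. h x * v x)"
proof (rule L2_tendstoI)
  note u = L2_tendstoD[OF assms(1)]
  show "L2_fun M (\<lambda>x. h x * u k x)" for k by (intro L2_fun_mult_bounded[OF _ assms(2,3)] u)
  show "L2_fun M (\<lambda>x. h x * v x)" by (intro L2_fun_mult_bounded[OF _ assms(2,3)] u)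
  show "sq_integral M (\<lambda>x. h x * u k x - h x * v x) \<le> C\<^sup>2 * sq_integral M (\<lambda>x. u k x - v x)" for k
    using sq_integral_mult_le[OF L2_fun_diff[OF u(1,2)] assms(2,3)] by (simp add: algebra_simps)
  show "(\<lambda>k. C\<^sup>2 * sq_integral M (\<lambda>x. u k x - v x)) \<longlonglongrightarrow> 0"
    by (intro tendsto_mult_right_zero u(3))
qed

lemma L2_tendsto_cmult: "L2_tendsto M u v \<Longrightarrow> L2_tendsto M (\<lambda>k x. c * u k x) (\<lambda>x. c * v x)"
  by (rule L2_tendsto_mult_bounded[where C = "cmod c"]) auto

text \<open>From 2 p q \<le> p^2 / e + e q^2. Continuity of the norm needs the factor of |b|^2 to be
  arbitrarily close to 1, which the constant 2 does not give.\<close>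

lemma cmod_sq_le_weighted:
  assumes "e > 0"
  shows "(cmod a)\<^sup>2 \<le> (1 + 1 / e) * (cmod (a - b))\<^sup>2 + (1 + e) * (cmod b)\<^sup>2"
proof -
  define p q where "p = cmod (a - b)" and "q = cmod b"
  have "cmod a \<le> p + q" unfolding p_def q_def by (metis diff_add_cancel norm_triangle_ineq)
  then have "(cmod a)\<^sup>2 \<le> (p + q)\<^sup>2" by (intro power_mono) auto
  also have "\<dots> \<le> (1 + 1 / e) * p\<^sup>2 + (1 + e) * q\<^sup>2"
  proof -
    have "0 \<le> (p - e * q)\<^sup>2 / e" using assms by simp
    also have "\<dots> = p\<^sup>2 / e + e * q\<^sup>2 - 2 * p * q"
      using assms by (simp add: field_simps power2_eq_square)
    finally show ?thesis by (simp add: power2_eq_square algebra_simps)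
  qed
  finally show ?thesis by (simp add: p_def q_def)
qed

lemma sq_integral_le_weighted:
  assumes "L2_fun M u" "L2_fun M v" "e > 0"
  shows "sq_integral M u \<le> (1 + 1 / e) * sq_integral M (\<lambda>x. u x - v x) + (1 + e) * sq_integral M v"
  by (rule sq_integral_bounded[OF L2_fun_measurable[OF assms(1)] L2_fun_diff[OF assms(1,2)] assms(2)])
     (simp add: cmod_sq_le_weighted[OF assms(3)])

lemma sq_integral_tendsto:
  assumes "L2_tendsto M u v"
  shows "(\<lambda>k. sq_integral M (u k)) \<longlonglongrightarrow> sq_integral M v"
proof (rule LIMSEQ_I)
  fix r :: real assume r: "r > 0"
  note u = L2_tendstoD[OF assms]
  define V where "V = sq_integral M v"
  \<comment> \<open>Chosen so that e times any norm square up to V + r costs at most r / 4; below, d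
    makes the term with the large factor 1 + 1/e cost r / 4 as well.\<close>
  define e where "e = min 1 (r / (4 * (V + r)))"
  have V: "V \<ge> 0" by (simp add: V_def)
  have e: "e > 0" "e \<le> 1" "e * (V + r) \<le> r / 4"
    using r V by (auto simp: e_def min_def field_simps)
  define d where "d = r / (4 * (1 + 1 / e))"
  have "1 + 1 / e > 0" using e(1) by (simp add: add_pos_pos)
  then have d: "d > 0" "(1 + 1 / e) * d = r / 4"
    unfolding d_def using r by (simp, metis nonzero_eq_divide_eq divide_divide_eq_left less_irrefl mult.commute)
  obtain K where K: "\<And>k. k \<ge> K \<Longrightarrow> sq_integral M (\<lambda>x. u k x - v x) < d"
    using LIMSEQ_D[OF u(3) d(1)] by auto
  have "norm (sq_integral M (u k) - V) < r" if k: "k \<ge> K" for k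
  proof -
    let ?S = "sq_integral M (u k)"
    have small: "(1 + 1 / e) * sq_integral M (\<lambda>x. u k x - v x) \<le> r / 4"
      using mult_left_mono[OF less_imp_le[OF K[OF k]], of "1 + 1 / e"] e d by auto
    have 1: "?S \<le> r / 4 + (1 + e) * V"
      using sq_integral_le_weighted[OF u(1)[of k] u(2) e(1)] small unfolding V_def by linarith
    have 2: "V \<le> r / 4 + (1 + e) * ?S"
      using sq_integral_le_weighted[OF u(2) u(1)[of k] e(1)] small
      unfolding V_def sq_integral_diff_commute[of M v] by linarith
    have eV: "e * V + e * r \<le> r / 4" using e(3) by (simp add: distrib_left)
    have "e * r > 0" "e * r \<le> r" using e r by auto
    \<comment> \<open>The upper bound comes first, because the lower one has to control e times the
      approximating norm square.\<close>
    have up: "?S \<le> V + r / 2" using 1 eV \<open>e * r > 0\<close> by (simp add: distrib_right)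
    then have "e * ?S \<le> e * (V + r / 2)" using e(1) by (intro mult_left_mono) auto
    then have "e * ?S \<le> r / 4" using eV \<open>e * r > 0\<close> by (simp add: distrib_left)
    then have "V \<le> r / 2 + ?S" using 2 by (simp add: distrib_right)
    with up r show ?thesis by (auto simp: abs_if)
  qed
  then show "\<exists>K. \<forall>k\<ge>K. norm (sq_integral M (u k) - sq_integral M v) < r"
    by (auto simp: V_def)
qed

text \<open>Along a fast subsequence the increments are summable in L1, by finiteness of the
  measure, so the subsequence converges almost everywhere; Fatou's lemma then turns the Cauchy
  property into convergence to the pointwise limit.\<close>

lemma Riesz_Fischer:
  fixes u :: "nat \<Rightarrow> 'a \<Rightarrow> complex"
  assumes fin: "finite_measure M" and L2: "\<And>k. L2_fun M (u k)"
    and cauchy: "\<And>e. e > 0 \<Longrightarrow> \<exists>K. \<forall>j\<ge>K. \<forall>k\<ge>K. sq_integral M (\<lambda>x. u j x - u k x) < e"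
  obtains g where "L2_tendsto M u g"
proof -
  interpret finite_measure M by fact
  have meas [measurable]: "u k \<in> borel_measurable M" for k
    using L2_fun_measurable[OF L2] .
  have "\<exists>K. \<forall>j\<ge>K. \<forall>k\<ge>K. sq_integral M (\<lambda>x. u j x - u k x) < (1 / 4) ^ n" for n :: nat
    by (rule cauchy) simp
  then obtain K where K: "\<And>n j k. j \<ge> K n \<Longrightarrow> k \<ge> K n \<Longrightarrow> sq_integral M (\<lambda>x. u j x - u k x) < (1 / 4) ^ n"
    by metis
  \<comment> \<open>The sum makes r monotone, r n \<ge> K n and r n \<ge> n all at once.\<close>
  define r where "r n = n + (\<Sum>i\<le>n. K i)" for n
  have rK: "r n \<ge> K n" and rSuc: "r (Suc n) \<ge> r n" and rn: "r n \<ge> n" for n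
    by (auto simp: r_def intro: trans_le_add2 member_le_sum)
  define w where "w n x = u (r (Suc n)) x - u (r n) x" for n x
  have w_meas [measurable]: "w n \<in> borel_measurable M" for n unfolding w_def by measurable
  have w_bound: "(\<integral>\<^sup>+x. ennreal (cmod (w n x)) \<partial>M) \<le> ennreal ((1 + measure M (space M)) * (1 / 2) ^ n)" for n
  proof -
    have L2w: "L2_fun M (w n)" unfolding w_def by (intro L2_fun_diff L2)
    have sqw: "sq_integral M (w n) \<le> (1 / 4) ^ n"
      using K[of n "r (Suc n)" "r n"] rK[of n] rSuc[of n] by (simp add: w_def[abs_def])
    have int: "integrable M (\<lambda>x. 2 ^ n * (cmod (w n x))\<^sup>2 + (1 / 2) ^ n)"
      using L2_fun_integrable[OF L2w] by simp
    have "(\<integral>\<^sup>+x. ennreal (cmod (w n x)) \<partial>M) \<le> (\<integral>\<^sup>+x. ennreal (2 ^ n * (cmod (w n x))\<^sup>2 + (1 / 2) ^ n) \<partial>M)"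
    proof (intro nn_integral_mono ennreal_leI)
      fix x
      define c where "c = cmod (w n x)"
      \<comment> \<open>The weight 2^n balances the squared norm 4^-n of w n against the constant
        2^-n, so that both contributions to the L1 norm are of order 2^-n.\<close>
      have "0 \<le> 2 ^ n * (c - (1 / 2) ^ n)\<^sup>2" by simp
      also have "\<dots> = 2 ^ n * c\<^sup>2 - 2 * c * (2 ^ n * (1 / 2) ^ n) + (2 ^ n * (1 / 2) ^ n) * (1 / 2) ^ n"
        by (simp add: power2_eq_square algebra_simps)
      also have "2 ^ n * (1 / 2) ^ n = (1::real)" by (simp flip: power_mult_distrib)
      finally have "2 * c \<le> 2 ^ n * c\<^sup>2 + (1 / 2) ^ n" by simp
      moreover have "c \<ge> 0" by (simp add: c_def)
      ultimately show "c \<le> 2 ^ n * c\<^sup>2 + (1 / 2) ^ n" by simp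
    qed
    also have "\<dots> = ennreal (\<integral>x. 2 ^ n * (cmod (w n x))\<^sup>2 + (1 / 2) ^ n \<partial>M)"
      by (intro nn_integral_eq_integral int) auto
    also have "\<dots> \<le> ennreal ((1 + measure M (space M)) * (1 / 2) ^ n)"
    proof (rule ennreal_leI)
      have "(\<integral>x. 2 ^ n * (cmod (w n x))\<^sup>2 + (1 / 2) ^ n \<partial>M) = 2 ^ n * sq_integral M (w n) + (1 / 2) ^ n * measure M (space M)"
        using L2_fun_integrable[OF L2w] by (simp add: sq_integral_def)
      also have "\<dots> \<le> 2 ^ n * (1 / 4) ^ n + (1 / 2) ^ n * measure M (space M)"
        using sqw by (intro add_mono mult_left_mono) auto
      also have "2 ^ n * (1 / 4 :: real) ^ n = (1 / 2) ^ n" by (simp flip: power_mult_distrib)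
      finally show "(\<integral>x. 2 ^ n * (cmod (w n x))\<^sup>2 + (1 / 2) ^ n \<partial>M) \<le> (1 + measure M (space M)) * (1 / 2) ^ n"
        by (simp add: algebra_simps)
    qed
    finally show ?thesis .
  qed
  have "(\<integral>\<^sup>+x. (\<Sum>n. ennreal (cmod (w n x))) \<partial>M) = (\<Sum>n. \<integral>\<^sup>+x. ennreal (cmod (w n x)) \<partial>M)"
    by (rule nn_integral_suminf) measurable
  also have "\<dots> \<le> (\<Sum>n. ennreal ((1 + measure M (space M)) * (1 / 2) ^ n))"
    by (intro suminf_le w_bound) auto
  also have "\<dots> < \<infinity>"
    by (subst suminf_ennreal2) (auto intro!: summable_mult summable_geometric)
  finally have "AE x in M. (\<Sum>n. ennreal (cmod (w n x))) \<noteq> \<infinity>"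
    by (intro nn_integral_PInf_AE) auto
  then have AE_conv: "AE x in M. convergent (\<lambda>n. u (r n) x)"
  proof eventually_elim
    fix x assume "(\<Sum>n. ennreal (cmod (w n x))) \<noteq> \<infinity>"
    then have "summable (\<lambda>n. cmod (w n x))"
      by (intro summable_suminf_not_top) auto
    then have "summable (\<lambda>n. w n x)" by (rule summable_norm_cancel)
    then have "convergent (\<lambda>n. \<Sum>i<n. w i x)" by (simp add: summable_iff_convergent)
    then have "convergent (\<lambda>n. (\<Sum>i<n. w i x) + u (r 0) x)"
      by (intro convergent_add convergent_const)
    moreover have "(\<Sum>i<n. w i x) + u (r 0) x = u (r n) x" for n
      unfolding w_def by (subst sum_lessThan_telescope) simp
    ultimately show "convergent (\<lambda>n. u (r n) x)" by simp
  qed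
  \<comment> \<open>\<open>lim\<close> is total, so g is defined and measurable everywhere; its
    values where the sequence diverges lie on a null set.\<close>
  define g where "g x = lim (\<lambda>n. u (r n) x)" for x
  have g_meas [measurable]: "g \<in> borel_measurable M" unfolding g_def by measurable
  \<comment> \<open>As r n \<ge> n, the subsequence eventually passes N, so the limit inferior of
    the integrals is at most e.\<close>
  have fatou: "(\<integral>\<^sup>+x. ennreal ((cmod (u j x - g x))\<^sup>2) \<partial>M) \<le> ennreal e"
    if e: "e > 0" and j: "\<And>k. k \<ge> N \<Longrightarrow> sq_integral M (\<lambda>x. u j x - u k x) < e" for e j N
  proof -
    have "(\<integral>\<^sup>+x. ennreal ((cmod (u j x - g x))\<^sup>2) \<partial>M)
        = (\<integral>\<^sup>+x. liminf (\<lambda>n. ennreal ((cmod (u j x - u (r n) x))\<^sup>2)) \<partial>M)"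
    proof (rule nn_integral_cong_AE, use AE_conv in eventually_elim)
      fix x assume "convergent (\<lambda>n. u (r n) x)"
      then have "(\<lambda>n. u (r n) x) \<longlonglongrightarrow> g x" by (simp add: g_def convergent_LIMSEQ_iff)
      then have "(\<lambda>n. ennreal ((cmod (u j x - u (r n) x))\<^sup>2)) \<longlonglongrightarrow> ennreal ((cmod (u j x - g x))\<^sup>2)"
        by (intro tendsto_intros)
      then show "ennreal ((cmod (u j x - g x))\<^sup>2) = liminf (\<lambda>n. ennreal ((cmod (u j x - u (r n) x))\<^sup>2))"
        by (intro lim_imp_Liminf[symmetric]) auto
    qed
    also have "\<dots> \<le> liminf (\<lambda>n. \<integral>\<^sup>+x. ennreal ((cmod (u j x - u (r n) x))\<^sup>2) \<partial>M)"
      by (rule nn_integral_liminf) measurable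
    also have "\<dots> \<le> ennreal e"
    proof (rule Liminf_le)
      show "\<forall>\<^sub>F n in sequentially. (\<integral>\<^sup>+x. ennreal ((cmod (u j x - u (r n) x))\<^sup>2) \<partial>M) \<le> ennreal e"
        using eventually_ge_at_top[of N]
      proof eventually_elim
        fix n assume "n \<ge> N"
        then have "r n \<ge> N" using rn[of n] by simp
        then show "(\<integral>\<^sup>+x. ennreal ((cmod (u j x - u (r n) x))\<^sup>2) \<partial>M) \<le> ennreal e"
          using j[of "r n"] by (subst nn_integral_sq_eq) (auto intro!: L2_fun_diff L2 ennreal_leI)
      qed
    qed simp
    finally show ?thesis .
  qed
  have diff: "L2_fun M (\<lambda>x. u j x - g x) \<and> sq_integral M (\<lambda>x. u j x - g x) \<le> e"
    if "e > 0" "\<And>k. k \<ge> N \<Longrightarrow> sq_integral M (\<lambda>x. u j x - u k x) < e" for e j N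
  proof -
    note le = fatou[OF that]
    have "integrable M (\<lambda>x. (cmod (u j x - g x))\<^sup>2)"
      using le by (intro integrableI_bounded) (auto simp: top_unique less_top[symmetric])
    then have "L2_fun M (\<lambda>x. u j x - g x)" by (simp add: L2_fun_def)
    with le that(1) show ?thesis by (simp add: nn_integral_sq_eq)
  qed
  obtain N where "\<And>j k. j \<ge> N \<Longrightarrow> k \<ge> N \<Longrightarrow> sq_integral M (\<lambda>x. u j x - u k x) < 1"
    using cauchy[of 1] by auto
  then have "L2_fun M (\<lambda>x. u N x - g x)" using diff[of 1 N N] by auto
  from L2_fun_diff[OF L2[of N] this] have g: "L2_fun M g" by simp
  have "(\<lambda>k. sq_integral M (\<lambda>x. u k x - g x)) \<longlonglongrightarrow> 0"
  proof (rule LIMSEQ_I)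
    fix e :: real assume e: "e > 0"
    then obtain N where N: "\<And>j k. j \<ge> N \<Longrightarrow> k \<ge> N \<Longrightarrow> sq_integral M (\<lambda>x. u j x - u k x) < e / 2"
      using cauchy[of "e / 2"] by auto
    have "sq_integral M (\<lambda>x. u k x - g x) \<le> e / 2" if "k \<ge> N" for k
      using diff[of "e / 2" N k] N that e by auto
    with e show "\<exists>N. \<forall>k\<ge>N. norm (sq_integral M (\<lambda>x. u k x - g x) - 0) < e"
      by (force intro!: exI[of _ N])
  qed
  with g L2 have "L2_tendsto M u g" by (simp add: L2_tendsto_def)
  then show thesis by (rule that)
qed

section \<open>Haar measure on the dual group\<close>

text \<open>Two different functions are separated by such sets at a coordinate where they differ.
  This makes the function space Hausdorff, as the Stone-Weierstrass setting below requires.\<close>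

lemma open_coordinate_vimage:
  fixes W :: "'b::topological_space set"
  shows "open W \<Longrightarrow> open ((\<lambda>h::'a \<Rightarrow> 'b. h x) -` W)"
  by (intro open_vimage) auto

text \<open>
  The order of the three instances matters: functions on a countable type are already a metric
  space, and an arity for a class has to be covered by the arities of its superclasses.
\<close>

instance "fun" :: (type, t0_space) t0_space
proof
  fix f g :: "'a \<Rightarrow> 'b" assume "f \<noteq> g"
  then obtain x where x: "f x \<noteq> g x" by auto
  obtain U where "open U" "\<not> (f x \<in> U \<longleftrightarrow> g x \<in> U)"
    using t0_space_class.t0_space[OF x] by blast
  with open_coordinate_vimage[of U x] show "\<exists>U. open U \<and> \<not> (f \<in> U \<longleftrightarrow> g \<in> U)"
    by (intro exI[of _ "(\<lambda>h. h x) -` U"]) simp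
qed

instance "fun" :: (type, t1_space) t1_space
proof
  fix f g :: "'a \<Rightarrow> 'b" assume "f \<noteq> g"
  then obtain x where x: "f x \<noteq> g x" by auto
  obtain U where "open U" "f x \<in> U" "g x \<notin> U"
    using t1_space[OF x] by blast
  with open_coordinate_vimage[of U x] show "\<exists>U. open U \<and> f \<in> U \<and> g \<notin> U"
    by (intro exI[of _ "(\<lambda>h. h x) -` U"]) simp
qed

instance "fun" :: (type, t2_space) t2_space
proof
  fix f g :: "'a \<Rightarrow> 'b" assume "f \<noteq> g"
  then obtain x where x: "f x \<noteq> g x" by auto
  obtain U V where "open U" "open V" "f x \<in> U" "g x \<in> V" "U \<inter> V = {}"
    using hausdorff[OF x] by blast
  with open_coordinate_vimage[of U x] open_coordinate_vimage[of V x]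
  show "\<exists>U V. open U \<and> open V \<and> f \<in> U \<and> g \<in> V \<and> U \<inter> V = {}"
    by (intro exI[of _ "(\<lambda>h. h x) -` U"] exI[of _ "(\<lambda>h. h x) -` V"]) (simp flip: vimage_Int)
qed

section \<open>The dual group as a compact group\<close>

lemma dual_group_add: "\<xi> \<in> dual_group \<Longrightarrow> \<xi> (m + n) = \<xi> m * \<xi> n"
  by (simp add: dual_group_def)

lemma dual_group_norm: "\<xi> \<in> dual_group \<Longrightarrow> cmod (\<xi> n) = 1"
  by (simp add: dual_group_def)

lemma dual_group_zero: "\<xi> \<in> dual_group \<Longrightarrow> \<xi> 0 = 1"
  using dual_group_add[of \<xi> 0 0] dual_group_norm[of \<xi> 0]
  by (metis add_0 mult_cancel_right1 norm_zero zero_neq_one)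

lemma dual_group_minus: "\<xi> \<in> dual_group \<Longrightarrow> \<xi> (- n) = cnj (\<xi> n)"
proof -
  assume \<xi>: "\<xi> \<in> dual_group"
  have "\<xi> n * \<xi> (- n) = 1"
    using dual_group_add[OF \<xi>, of n "- n"] dual_group_zero[OF \<xi>] by simp
  moreover have "\<xi> n * cnj (\<xi> n) = 1"
    using dual_group_norm[OF \<xi>, of n] by (simp flip: complex_norm_square)
  ultimately show ?thesis
    by (metis mult_cancel_left zero_neq_one mult_zero_left)
qed

lemma dual_group_mult: "\<xi> \<in> dual_group \<Longrightarrow> \<eta> \<in> dual_group \<Longrightarrow> (\<lambda>n. \<xi> n * \<eta> n) \<in> dual_group"
  by (simp add: dual_group_def norm_mult)

lemma dual_group_cnj: "\<xi> \<in> dual_group \<Longrightarrow> (\<lambda>n. cnj (\<xi> n)) \<in> dual_group"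
  by (simp add: dual_group_def)

lemma closed_dual_group: "closed (dual_group :: ('n::ab_group_add \<Rightarrow> complex) set)"
  unfolding dual_group_def
  by (intro closed_Collect_conj closed_Collect_all closed_Collect_eq continuous_intros) auto

text \<open>Tychonoff: the dual is a closed subset of a product of circles.\<close>

lemma compact_dual_group: "compact (dual_group :: ('n::ab_group_add \<Rightarrow> complex) set)"
proof -
  have "compactin (product_topology (\<lambda>_. euclidean) UNIV) (PiE (UNIV::'n set) (\<lambda>_. sphere (0::complex) 1))"
    by (simp add: compactin_PiE)
  then have "compact (PiE (UNIV::'n set) (\<lambda>_. sphere (0::complex) 1))"
    by (simp add: euclidean_product_topology)
  then have "compact (PiE (UNIV::'n set) (\<lambda>_. sphere (0::complex) 1) \<inter> dual_group)"
    by (intro compact_Int_closed closed_dual_group)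
  moreover have "PiE (UNIV::'n set) (\<lambda>_. sphere (0::complex) 1) \<inter> dual_group = dual_group"
    by (auto simp: dual_group_def)
  ultimately show ?thesis by simp
qed

text \<open>The sign in \<xi>(-n) matches the Fourier transform. The formula is required on the dual
  group only, because products and conjugates of characters reduce to characters only there.\<close>

definition trig_poly :: "(('n::ab_group_add \<Rightarrow> complex) \<Rightarrow> complex) \<Rightarrow> bool" where
  "trig_poly p \<longleftrightarrow> (\<exists>S c. finite S \<and> (\<forall>\<xi>\<in>dual_group. p \<xi> = (\<Sum>n\<in>S. c n * \<xi> (- n))))"

lemma trig_polyI:
  "finite S \<Longrightarrow> (\<And>\<xi>. \<xi> \<in> dual_group \<Longrightarrow> p \<xi> = (\<Sum>n\<in>S. c n * \<xi> (- n))) \<Longrightarrow> trig_poly p"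
  unfolding trig_poly_def by blast

lemma trig_poly_cong:
  "trig_poly p \<Longrightarrow> (\<And>\<xi>. \<xi> \<in> dual_group \<Longrightarrow> q \<xi> = p \<xi>) \<Longrightarrow> trig_poly q"
  unfolding trig_poly_def by metis

lemma trig_poly_monomial: "trig_poly (\<lambda>\<xi>. c * \<xi> n)"
  by (rule trig_polyI[of "{- n}" _ "\<lambda>_. c"]) auto

lemma trig_poly_const: "trig_poly (\<lambda>_. c)"
  by (rule trig_poly_cong[OF trig_poly_monomial[of c 0]]) (simp add: dual_group_zero)

lemma trig_poly_add:
  assumes "trig_poly p" "trig_poly q"
  shows "trig_poly (\<lambda>\<xi>. p \<xi> + q \<xi>)"
proof -
  obtain S c where S: "finite S" "\<And>\<xi>. \<xi> \<in> dual_group \<Longrightarrow> p \<xi> = (\<Sum>n\<in>S. c n * \<xi> (- n))"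
    using assms(1) by (auto simp: trig_poly_def)
  obtain T d where T: "finite T" "\<And>\<xi>. \<xi> \<in> dual_group \<Longrightarrow> q \<xi> = (\<Sum>n\<in>T. d n * \<xi> (- n))"
    using assms(2) by (auto simp: trig_poly_def)
  show ?thesis
  proof (rule trig_polyI[of "S \<union> T" _ "\<lambda>n. (if n \<in> S then c n else 0) + (if n \<in> T then d n else 0)"])
    fix \<xi> :: "'a \<Rightarrow> complex" assume \<xi>: "\<xi> \<in> dual_group"
    have "(\<Sum>n\<in>S. c n * \<xi> (- n)) = (\<Sum>n\<in>S \<union> T. (if n \<in> S then c n else 0) * \<xi> (- n))"
      using S(1) T(1) by (intro sum.mono_neutral_cong_left) auto
    moreover have "(\<Sum>n\<in>T. d n * \<xi> (- n)) = (\<Sum>n\<in>S \<union> T. (if n \<in> T then d n else 0) * \<xi> (- n))"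
      using S(1) T(1) by (intro sum.mono_neutral_cong_left) auto
    ultimately show "p \<xi> + q \<xi> = (\<Sum>n\<in>S \<union> T. ((if n \<in> S then c n else 0) + (if n \<in> T then d n else 0)) * \<xi> (- n))"
      by (simp only: S(2)[OF \<xi>] T(2)[OF \<xi>] distrib_right sum.distrib)
  qed (use S T in auto)
qed

lemma trig_poly_sum: "(\<And>i. i \<in> I \<Longrightarrow> trig_poly (p i)) \<Longrightarrow> trig_poly (\<lambda>\<xi>. \<Sum>i\<in>I. p i \<xi>)"
  by (induction I rule: infinite_finite_induct) (auto intro: trig_poly_add trig_poly_const)

lemma trig_poly_mult:
  assumes "trig_poly p" "trig_poly q"
  shows "trig_poly (\<lambda>\<xi>. p \<xi> * q \<xi>)"
proof -
  obtain S c where S: "finite S" "\<And>\<xi>. \<xi> \<in> dual_group \<Longrightarrow> p \<xi> = (\<Sum>n\<in>S. c n * \<xi> (- n))"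
    using assms(1) by (auto simp: trig_poly_def)
  obtain T d where T: "finite T" "\<And>\<xi>. \<xi> \<in> dual_group \<Longrightarrow> q \<xi> = (\<Sum>n\<in>T. d n * \<xi> (- n))"
    using assms(2) by (auto simp: trig_poly_def)
  have "trig_poly (\<lambda>\<xi>. \<Sum>n\<in>S. \<Sum>m\<in>T. (c n * d m) * \<xi> (- n + - m))"
    by (intro trig_poly_sum trig_poly_monomial)
  then show ?thesis
  proof (rule trig_poly_cong)
    fix \<xi> :: "'a \<Rightarrow> complex" assume \<xi>: "\<xi> \<in> dual_group"
    show "p \<xi> * q \<xi> = (\<Sum>n\<in>S. \<Sum>m\<in>T. (c n * d m) * \<xi> (- n + - m))"
      unfolding S(2)[OF \<xi>] T(2)[OF \<xi>] sum_product dual_group_add[OF \<xi>]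
      by (intro sum.cong refl) (simp add: ac_simps)
  qed
qed

lemma continuous_on_coordinate: "continuous_on A (\<lambda>\<xi>::'a \<Rightarrow> 'b::topological_space. \<xi> n)"
  by (rule continuous_on_subset[OF continuous_on_product_coordinates]) simp

lemma continuous_on_trig_poly:
  assumes "trig_poly p"
  shows "continuous_on dual_group p"
proof -
  obtain S c where S: "finite S" "\<And>\<xi>. \<xi> \<in> dual_group \<Longrightarrow> p \<xi> = (\<Sum>n\<in>S. c n * \<xi> (- n))"
    using assms by (auto simp: trig_poly_def)
  have "continuous_on dual_group (\<lambda>\<xi>. \<Sum>n\<in>S. c n * \<xi> (- n))"
    by (intro continuous_intros continuous_on_coordinate)
  then show ?thesis using S(2) by (simp cong: continuous_on_cong)
qed

abbreviation real_trig_poly :: "(('n::ab_group_add \<Rightarrow> complex) \<Rightarrow> real) \<Rightarrow> bool" where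
  "real_trig_poly q \<equiv> trig_poly (\<lambda>\<xi>. complex_of_real (q \<xi>))"

text \<open>The hypotheses of Stone-Weierstrass. Real and imaginary parts of coordinates separate
  points, and they are polynomials because \<xi>(-n) is the conjugate of \<xi>(n).\<close>

lemma function_ring_real_trig_poly:
  "function_ring_on (Collect real_trig_poly :: (('n::ab_group_add \<Rightarrow> complex) \<Rightarrow> real) set) dual_group"
proof
  show "compact (dual_group :: ('n \<Rightarrow> complex) set)" by (rule compact_dual_group)
next
  fix f :: "('n \<Rightarrow> complex) \<Rightarrow> real" assume "f \<in> Collect real_trig_poly"
  then have "continuous_on dual_group (\<lambda>\<xi>. Re (complex_of_real (f \<xi>)))"
    by (intro continuous_on_Re continuous_on_trig_poly) simp
  then show "continuous_on dual_group f" by simp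
next
  fix f g :: "('n \<Rightarrow> complex) \<Rightarrow> real"
  assume "f \<in> Collect real_trig_poly" "g \<in> Collect real_trig_poly"
  then show "(\<lambda>x. f x + g x) \<in> Collect real_trig_poly" "(\<lambda>x. f x * g x) \<in> Collect real_trig_poly"
    by (auto intro: trig_poly_add trig_poly_mult)
next
  fix c :: real
  show "(\<lambda>_. c) \<in> (Collect real_trig_poly :: (('n \<Rightarrow> complex) \<Rightarrow> real) set)"
    by (simp add: trig_poly_const)
next
  fix x y :: "'n \<Rightarrow> complex" assume xy: "x \<in> dual_group" "y \<in> dual_group" "x \<noteq> y"
  then obtain n where n: "x n \<noteq> y n" by auto
  have Re: "real_trig_poly (\<lambda>\<xi>::'n \<Rightarrow> complex. Re (\<xi> n))"
    by (rule trig_poly_cong[OF trig_poly_add[OF trig_poly_monomial[of "1 / 2" n] trig_poly_monomial[of "1 / 2" "- n"]]])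
       (simp add: dual_group_minus complex_eq_iff)
  have Im: "real_trig_poly (\<lambda>\<xi>::'n \<Rightarrow> complex. Im (\<xi> n))"
    by (rule trig_poly_cong[OF trig_poly_add[OF trig_poly_monomial[of "- \<i> / 2" n] trig_poly_monomial[of "\<i> / 2" "- n"]]])
       (simp add: dual_group_minus complex_eq_iff)
  show "\<exists>f\<in>Collect real_trig_poly. f x \<noteq> f y"
  proof (cases "Re (x n) = Re (y n)")
    case True
    then have "Im (x n) \<noteq> Im (y n)" using n by (simp add: complex_eq_iff)
    with Im show ?thesis by (intro bexI[of _ "\<lambda>\<xi>. Im (\<xi> n)"]) auto
  next
    case False
    with Re show ?thesis by (intro bexI[of _ "\<lambda>\<xi>. Re (\<xi> n)"]) auto
  qed
qed

lemma abs_diff_indicator_le_one: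
  fixes t :: real
  shows "0 \<le> t \<and> t \<le> 1 \<Longrightarrow> \<bar>t - indicator A x\<bar> \<le> 1"
  by (auto simp: indicator_def)

section \<open>Invariance of Haar measure and orthogonality of characters\<close>

locale dual_haar =
  fixes \<mu> :: "('n::ab_group_add \<Rightarrow> complex) measure"
  assumes haar: "haar_dual \<mu>"
begin

lemma sets_mu: "sets \<mu> = sets (restrict_space borel dual_group)"
  using haar by (simp add: haar_dual_def)

lemma space_mu: "space \<mu> = dual_group"
  using sets_eq_imp_space_eq[OF sets_mu] by (simp add: space_restrict_space)

sublocale prob_space \<mu>
  using haar by (intro prob_spaceI) (simp add: haar_dual_def)

lemma open_Int_sets: "open U \<Longrightarrow> U \<inter> dual_group \<in> sets \<mu>"
  unfolding sets_mu sets_restrict_space by (auto simp: Int_commute)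

lemma measurable_mu_iff: "f \<in> measurable \<mu> N \<longleftrightarrow> f \<in> measurable (restrict_space borel dual_group) N"
  using measurable_cong_sets[OF sets_mu refl] by blast

lemma continuous_measurable_mu: "continuous_on dual_group f \<Longrightarrow> f \<in> borel_measurable \<mu>"
  unfolding measurable_mu_iff by (rule borel_measurable_continuous_on_restrict)

lemma trig_poly_measurable: "trig_poly p \<Longrightarrow> p \<in> borel_measurable \<mu>"
  by (intro continuous_measurable_mu continuous_on_trig_poly)

lemma real_trig_poly_measurable: "real_trig_poly q \<Longrightarrow> q \<in> borel_measurable \<mu>"
  using trig_poly_measurable[of "\<lambda>\<xi>. complex_of_real (q \<xi>)"] by (simp add: borel_measurable_complex_iff)

lemma character_measurable [measurable]: "(\<lambda>\<xi>. \<xi> n) \<in> borel_measurable \<mu>"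
  by (intro continuous_measurable_mu continuous_on_coordinate)

lemma character_integrable: "integrable \<mu> (\<lambda>\<xi>. \<xi> n)"
  by (rule integrable_const_bound[of _ 1]) (auto simp: space_mu dual_group_norm)

lemma translation_measurable:
  assumes "\<xi> \<in> dual_group"
  shows "(\<lambda>\<eta> n. \<xi> n * \<eta> n) \<in> measurable \<mu> \<mu>"
proof -
  have "(\<lambda>\<eta> n. \<xi> n * \<eta> n) \<in> measurable (restrict_space borel dual_group) (restrict_space borel dual_group)"
  proof (rule measurable_restrict_space2)
    show "(\<lambda>\<eta> n. \<xi> n * \<eta> n) \<in> space (restrict_space borel dual_group) \<rightarrow> dual_group"
      using assms by (auto simp: space_restrict_space intro: dual_group_mult)
    have "continuous_on dual_group (\<lambda>\<eta> n. \<xi> n * \<eta> n)"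
      by (intro continuous_intros continuous_on_coordinate)
    then show "(\<lambda>\<eta> n. \<xi> n * \<eta> n) \<in> borel_measurable (restrict_space borel dual_group)"
      by (rule borel_measurable_continuous_on_restrict)
  qed
  then show ?thesis
    using measurable_cong_sets[OF sets_mu sets_mu] by blast
qed

text \<open>Invariance is given for images of sets, whereas a push-forward involves preimages; the
  preimage under \<xi> is the image under the conjugate character.\<close>

lemma distr_translation:
  assumes \<xi>: "\<xi> \<in> dual_group"
  shows "distr \<mu> \<mu> (\<lambda>\<eta> n. \<xi> n * \<eta> n) = \<mu>"
proof (rule measure_eqI)
  fix A assume "A \<in> sets (distr \<mu> \<mu> (\<lambda>\<eta> n. \<xi> n * \<eta> n))"
  then have A: "A \<in> sets \<mu>" by simp
  then have sub: "A \<subseteq> dual_group" using sets.sets_into_space space_mu by blast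
  have unit: "\<xi> n * cnj (\<xi> n) = 1" "cnj (\<xi> n) * \<xi> n = 1" for n
    using dual_group_norm[OF \<xi>, of n] by (simp_all flip: complex_norm_square add: mult.commute)
  have "(\<lambda>\<eta> n. \<xi> n * \<eta> n) -` A \<inter> space \<mu> = (\<lambda>\<eta> n. cnj (\<xi> n) * \<eta> n) ` A"
  proof (intro subset_antisym subsetI)
    fix \<eta> assume "\<eta> \<in> (\<lambda>\<eta> n. \<xi> n * \<eta> n) -` A \<inter> space \<mu>"
    then show "\<eta> \<in> (\<lambda>\<eta> n. cnj (\<xi> n) * \<eta> n) ` A"
      by (intro image_eqI[of _ _ "\<lambda>n. \<xi> n * \<eta> n"]) (auto simp: unit mult.assoc[symmetric])
  next
    fix \<eta> assume "\<eta> \<in> (\<lambda>\<eta> n. cnj (\<xi> n) * \<eta> n) ` A"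
    then obtain \<zeta> where "\<zeta> \<in> A" "\<eta> = (\<lambda>n. cnj (\<xi> n) * \<zeta> n)" by auto
    then show "\<eta> \<in> (\<lambda>\<eta> n. \<xi> n * \<eta> n) -` A \<inter> space \<mu>"
      using sub \<xi> by (auto simp: unit mult.assoc[symmetric] space_mu intro: dual_group_mult dual_group_cnj)
  qed
  then show "emeasure (distr \<mu> \<mu> (\<lambda>\<eta> n. \<xi> n * \<eta> n)) A = emeasure \<mu> A"
    using A dual_group_cnj[OF \<xi>] haar
    by (simp add: emeasure_distr translation_measurable[OF \<xi>] haar_dual_def)
qed simp

text \<open>Translating by \<xi> multiplies the integral by \<xi>(n), so it vanishes as soon as some
  \<xi>(n) differs from 1.\<close>

lemma integral_character: "(\<integral>\<xi>. \<xi> n \<partial>\<mu>) = of_bool (n = 0)"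
proof (cases "n = 0")
  case True
  have "(\<integral>\<xi>. \<xi> n \<partial>\<mu>) = (\<integral>\<xi>. 1 \<partial>\<mu>)"
    by (rule Bochner_Integration.integral_cong) (auto simp: True space_mu dual_group_zero)
  then show ?thesis using True by (simp add: prob_space)
next
  case False
  then obtain \<xi> where \<xi>: "\<xi> \<in> dual_group" "\<xi> n \<noteq> 1"
    using dual_group_separates_zero by blast
  have "(\<integral>\<eta>. \<eta> n \<partial>\<mu>) = (\<integral>\<eta>. \<eta> n \<partial>(distr \<mu> \<mu> (\<lambda>\<eta> n. \<xi> n * \<eta> n)))"
    by (simp add: distr_translation[OF \<xi>(1)])
  also have "\<dots> = (\<integral>\<eta>. \<xi> n * \<eta> n \<partial>\<mu>)"
    by (rule integral_distr[OF translation_measurable[OF \<xi>(1)]]) measurable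
  also have "\<dots> = \<xi> n * (\<integral>\<eta>. \<eta> n \<partial>\<mu>)" by simp
  finally show ?thesis using \<xi>(2) False by simp
qed

lemma L2_fun_trig_poly:
  assumes "trig_poly p"
  shows "L2_fun \<mu> p"
proof -
  have "compact (p ` dual_group)"
    by (intro compact_continuous_image continuous_on_trig_poly assms compact_dual_group)
  then obtain C where C: "\<And>\<xi>. \<xi> \<in> dual_group \<Longrightarrow> cmod (p \<xi>) \<le> C"
    by (metis bounded_iff compact_imp_bounded imageI)
  have [measurable]: "p \<in> borel_measurable \<mu>" by (rule trig_poly_measurable[OF assms])
  have "integrable \<mu> (\<lambda>\<xi>. (cmod (p \<xi>))\<^sup>2)"
    by (rule integrable_const_bound[of _ "C\<^sup>2"]) (auto simp: space_mu intro!: power_mono C)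
  then show ?thesis by (simp add: L2_fun_def)
qed

lemma sq_integral_trig_poly:
  assumes "finite S"
  shows "sq_integral \<mu> (\<lambda>\<xi>. \<Sum>n\<in>S. c n * \<xi> (- n)) = (\<Sum>n\<in>S. (cmod (c n))\<^sup>2)"
proof -
  have "complex_of_real (sq_integral \<mu> (\<lambda>\<xi>. \<Sum>n\<in>S. c n * \<xi> (- n)))
      = (\<integral>\<xi>. complex_of_real ((cmod (\<Sum>n\<in>S. c n * \<xi> (- n)))\<^sup>2) \<partial>\<mu>)"
    unfolding sq_integral_def by (rule integral_complex_of_real[symmetric])
  also have "\<dots> = (\<integral>\<xi>. (\<Sum>n\<in>S. \<Sum>m\<in>S. (c n * cnj (c m)) * \<xi> (m - n)) \<partial>\<mu>)"
  proof (rule Bochner_Integration.integral_cong)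
    fix \<xi> assume "\<xi> \<in> space \<mu>"
    then have \<xi>: "\<xi> \<in> dual_group" by (simp add: space_mu)
    have "\<xi> (- n) * cnj (\<xi> (- m)) = \<xi> (m - n)" for m n
      using dual_group_add[OF \<xi>, of "- n" m] dual_group_minus[OF \<xi>, of "- m"] by simp
    then show "complex_of_real ((cmod (\<Sum>n\<in>S. c n * \<xi> (- n)))\<^sup>2) = (\<Sum>n\<in>S. \<Sum>m\<in>S. (c n * cnj (c m)) * \<xi> (m - n))"
      unfolding complex_norm_square cnj_sum sum_product
      by (intro sum.cong refl) (simp add: mult_ac)
  qed simp
  also have "\<dots> = (\<Sum>n\<in>S. \<Sum>m\<in>S. (c n * cnj (c m)) * of_bool (m - n = 0))"
    by (simp add: Bochner_Integration.integral_sum character_integrable integral_character)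
  also have "\<dots> = (\<Sum>n\<in>S. \<Sum>m\<in>S. if m = n then c n * cnj (c m) else 0)"
    by (intro sum.cong refl) auto
  also have "\<dots> = (\<Sum>n\<in>S. c n * cnj (c n))"
    using assms by simp
  also have "\<dots> = complex_of_real (\<Sum>n\<in>S. (cmod (c n))\<^sup>2)"
    by (simp add: complex_norm_square del: of_real_power)
  finally show ?thesis by (simp only: of_real_eq_iff)
qed

section \<open>Approximation of Borel sets by trigonometric polynomials\<close>

lemma outer_approx:
  assumes A: "A \<in> sets \<mu>" and e: "e > 0"
  obtains U where "open U" "A \<subseteq> U" "measure \<mu> (U \<inter> dual_group - A) < e"
proof -
  have "emeasure \<mu> A < emeasure \<mu> A + ennreal e"
    using e by (simp add: emeasure_eq_measure ennreal_plus[symmetric] ennreal_less_iff del: ennreal_plus)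
  moreover have "emeasure \<mu> A = (INF U\<in>{U. open U \<and> A \<subseteq> U}. emeasure \<mu> (U \<inter> dual_group))"
    using haar A by (simp add: haar_dual_def)
  ultimately obtain U where U: "open U" "A \<subseteq> U" "emeasure \<mu> (U \<inter> dual_group) < emeasure \<mu> A + ennreal e"
    by (auto simp: INF_less_iff)
  have "measure \<mu> (U \<inter> dual_group) < measure \<mu> A + e"
    using U(3) e by (simp add: emeasure_eq_measure ennreal_plus[symmetric] ennreal_less_iff del: ennreal_plus)
  moreover have "A \<subseteq> U \<inter> dual_group" using U(2) A sets.sets_into_space space_mu by blast
  ultimately have "measure \<mu> (U \<inter> dual_group - A) < e"
    using A open_Int_sets[OF U(1)] by (simp add: finite_measure_Diff)
  with U that show thesis by blast
qed

text \<open>Outer regularity is applied to A and to its complement. The parts of the dual outside U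
  and outside V are then disjoint closed sets, and the separation step of Stone-Weierstrass yields q
  close to 0 on the first and close to 1 on the second.\<close>

lemma indicator_approx_L1:
  assumes A: "A \<in> sets \<mu>" and e: "e > 0"
  obtains q where "real_trig_poly q" "\<And>\<xi>. \<xi> \<in> dual_group \<Longrightarrow> 0 \<le> q \<xi> \<and> q \<xi> \<le> 1"
    "(\<integral>\<xi>. \<bar>q \<xi> - indicator A \<xi>\<bar> \<partial>\<mu>) < e"
proof -
  \<comment> \<open>Three errors below or equal to e / 4 stay below e; the separation step also asks
    for d < 1.\<close>
  define d where "d = min (e / 4) (1 / 2)"
  have d: "d > 0" "d < 1" "d \<le> e / 4" using e by (auto simp: d_def)
  have subA: "A \<subseteq> dual_group" using A sets.sets_into_space space_mu by blast
  obtain U where U: "open U" "A \<subseteq> U" "measure \<mu> (U \<inter> dual_group - A) < d"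
    using outer_approx[OF A d(1)] by blast
  have B: "dual_group - A \<in> sets \<mu>" using A space_mu sets.compl_sets by metis
  obtain V where V: "open V" "dual_group - A \<subseteq> V" "measure \<mu> (V \<inter> dual_group - (dual_group - A)) < d"
    using outer_approx[OF B d(1)] by blast
  have "\<exists>q\<in>Collect real_trig_poly. q ` dual_group \<subseteq> {0..1} \<and>
      (\<forall>\<xi>\<in>dual_group - U. q \<xi> < d) \<and> (\<forall>\<xi>\<in>dual_group - V. q \<xi> > 1 - d)"
    using U V d closed_dual_group
    by (intro function_ring_on.two[OF function_ring_real_trig_poly]) (auto intro: closed_Diff)
  then obtain q where q: "real_trig_poly q" "\<And>\<xi>. \<xi> \<in> dual_group \<Longrightarrow> 0 \<le> q \<xi> \<and> q \<xi> \<le> 1"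
    "\<And>\<xi>. \<xi> \<in> dual_group - U \<Longrightarrow> q \<xi> < d" "\<And>\<xi>. \<xi> \<in> dual_group - V \<Longrightarrow> q \<xi> > 1 - d"
    by (auto simp: image_subset_iff)
  have [measurable]: "q \<in> borel_measurable \<mu>" by (rule real_trig_poly_measurable[OF q(1)])
  let ?X = "U \<inter> dual_group - A" and ?Y = "V \<inter> dual_group - (dual_group - A)"
  have XY: "?X \<in> sets \<mu>" "?Y \<in> sets \<mu>"
    using open_Int_sets[OF U(1)] open_Int_sets[OF V(1)] A B by auto
  \<comment> \<open>A point of A is either outside V, where q > 1 - d, or in ?Y; a point outside A
    is either outside U, where q < d, or in ?X. On ?X and ?Y the error is at most 1.\<close>
  have "(\<integral>\<xi>. \<bar>q \<xi> - indicator A \<xi>\<bar> \<partial>\<mu>) \<le> (\<integral>\<xi>. d + indicator ?X \<xi> + indicator ?Y \<xi> \<partial>\<mu>)"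
  proof (rule integral_mono)
    show "integrable \<mu> (\<lambda>\<xi>. \<bar>q \<xi> - indicator A \<xi>\<bar>)"
      using A q(2) by (intro integrable_const_bound[of _ 1]) (auto simp: space_mu intro!: AE_I2 abs_diff_indicator_le_one)
    show "integrable \<mu> (\<lambda>\<xi>. d + indicator ?X \<xi> + indicator ?Y \<xi>)"
      using XY by (intro Bochner_Integration.integrable_add integrable_const integrable_real_indicator) (auto simp: less_top[symmetric])
    show "\<bar>q \<xi> - indicator A \<xi>\<bar> \<le> d + indicator ?X \<xi> + indicator ?Y \<xi>" if "\<xi> \<in> space \<mu>" for \<xi>
      using that q(2)[of \<xi>] q(3)[of \<xi>] q(4)[of \<xi>] d U(2) V(2) subA
      by (auto simp: space_mu indicator_def abs_if)
  qed
  also have "\<dots> = d + measure \<mu> ?X + measure \<mu> ?Y"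
    using XY by (subst Bochner_Integration.integral_add integrable_const integrable_real_indicator;
        simp add: less_top[symmetric] prob_space)+
  also have "\<dots> < e" using U(3) V(3) d by simp
  finally show thesis using that q by blast
qed

text \<open>L1 convergence yields an almost everywhere convergent subsequence. The bounds 0 and 1
  are kept for dominated convergence.\<close>

lemma indicator_approx_AE:
  assumes A: "A \<in> sets \<mu>"
  obtains q :: "nat \<Rightarrow> ('n \<Rightarrow> complex) \<Rightarrow> real" where "\<And>k. real_trig_poly (q k)"
    "\<And>k \<xi>. \<xi> \<in> dual_group \<Longrightarrow> 0 \<le> q k \<xi> \<and> q k \<xi> \<le> 1"
    "AE \<xi> in \<mu>. (\<lambda>k. q k \<xi>) \<longlonglongrightarrow> indicator A \<xi>"
proof -
  have "\<exists>q. real_trig_poly q \<and> (\<forall>\<xi>\<in>dual_group. 0 \<le> q \<xi> \<and> q \<xi> \<le> 1) \<and>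
      (\<integral>\<xi>. \<bar>q \<xi> - indicator A \<xi>\<bar> \<partial>\<mu>) < inverse (real (Suc k))" for k
    by (rule indicator_approx_L1[OF A, of "inverse (real (Suc k))"]) auto
  then obtain q where q: "\<And>k. real_trig_poly (q k)" "\<And>k \<xi>. \<xi> \<in> dual_group \<Longrightarrow> 0 \<le> q k \<xi> \<and> q k \<xi> \<le> 1"
    "\<And>k. (\<integral>\<xi>. \<bar>q k \<xi> - indicator A \<xi>\<bar> \<partial>\<mu>) < inverse (real (Suc k))"
    by metis
  have [measurable]: "q k \<in> borel_measurable \<mu>" for k by (rule real_trig_poly_measurable[OF q(1)])
  have "\<exists>r. strict_mono r \<and> (AE \<xi> in \<mu>. (\<lambda>k. q (r k) \<xi> - indicator A \<xi>) \<longlonglongrightarrow> 0)"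
  proof (rule tendsto_L1_AE_subseq[of \<mu> "\<lambda>k \<xi>. q k \<xi> - indicator A \<xi>"])
    show "integrable \<mu> (\<lambda>\<xi>. q k \<xi> - indicator A \<xi>)" for k
      using A q(2) by (intro integrable_const_bound[of _ 1]) (auto simp: space_mu intro!: AE_I2 abs_diff_indicator_le_one)
    show "(\<lambda>k. \<integral>\<xi>. norm (q k \<xi> - indicator A \<xi>) \<partial>\<mu>) \<longlonglongrightarrow> 0"
      using q(3) by (intro tendsto_sandwich[OF _ _ tendsto_const LIMSEQ_inverse_real_of_nat])
        (auto intro!: less_imp_le always_eventually)
  qed
  then obtain r where r: "AE \<xi> in \<mu>. (\<lambda>k. q (r k) \<xi> - indicator A \<xi>) \<longlonglongrightarrow> 0" by blast
  show thesis
  proof (rule that[of "\<lambda>k. q (r k)"])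
    show "AE \<xi> in \<mu>. (\<lambda>k. q (r k) \<xi>) \<longlonglongrightarrow> indicator A \<xi>"
      using r by (simp add: LIM_zero_iff)
  qed (use q in auto)
qed

text \<open>Test against the set where g is negative: its indicator is a bounded limit of the q, and
  so of their squares. The limiting integral is both nonnegative and an integral of a nonpositive
  function, so the set is null.\<close>

lemma AE_nonneg_if_trig_poly:
  fixes g :: "('n \<Rightarrow> complex) \<Rightarrow> real"
  assumes g: "integrable \<mu> g" and pos: "\<And>q. real_trig_poly q \<Longrightarrow> 0 \<le> (\<integral>\<xi>. (q \<xi>)\<^sup>2 * g \<xi> \<partial>\<mu>)"
  shows "AE \<xi> in \<mu>. 0 \<le> g \<xi>"
proof -
  have [measurable]: "g \<in> borel_measurable \<mu>" using g by auto
  define A where "A = {\<xi> \<in> space \<mu>. g \<xi> < 0}"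
  have A: "A \<in> sets \<mu>" unfolding A_def by measurable
  obtain q where q: "\<And>k. real_trig_poly (q k)"
    "\<And>k \<xi>. \<xi> \<in> dual_group \<Longrightarrow> 0 \<le> q k \<xi> \<and> q k \<xi> \<le> 1"
    "AE \<xi> in \<mu>. (\<lambda>k. q k \<xi>) \<longlonglongrightarrow> indicator A \<xi>"
    using indicator_approx_AE[OF A] by blast
  have [measurable]: "q k \<in> borel_measurable \<mu>" for k by (rule real_trig_poly_measurable[OF q(1)])
  have "(\<lambda>k. \<integral>\<xi>. (q k \<xi>)\<^sup>2 * g \<xi> \<partial>\<mu>) \<longlonglongrightarrow> (\<integral>\<xi>. (indicator A \<xi>)\<^sup>2 * g \<xi> \<partial>\<mu>)"
  proof (rule integral_dominated_convergence[where w = "\<lambda>\<xi>. \<bar>g \<xi>\<bar>"])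
    show "AE \<xi> in \<mu>. (\<lambda>k. (q k \<xi>)\<^sup>2 * g \<xi>) \<longlonglongrightarrow> (indicator A \<xi>)\<^sup>2 * g \<xi>"
      using q(3) by eventually_elim (intro tendsto_intros)
    show "AE \<xi> in \<mu>. norm ((q k \<xi>)\<^sup>2 * g \<xi>) \<le> \<bar>g \<xi>\<bar>" for k
      using q(2)[of _ k] by (intro AE_I2) (auto simp: space_mu abs_mult power_le_one intro!: mult_left_le_one_le)
  qed (use A g in auto)
  then have "0 \<le> (\<integral>\<xi>. (indicator A \<xi>)\<^sup>2 * g \<xi> \<partial>\<mu>)"
    by (rule LIMSEQ_le_const) (use pos q(1) in auto)
  also have "(\<integral>\<xi>. (indicator A \<xi>)\<^sup>2 * g \<xi> \<partial>\<mu>) = - (\<integral>\<xi>. indicator A \<xi> * (- g \<xi>) \<partial>\<mu>)"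
  proof -
    have "(\<lambda>\<xi>. (indicator A \<xi>)\<^sup>2 * g \<xi>) = (\<lambda>\<xi>. - (indicator A \<xi> * (- g \<xi>)))"
      by (auto simp: fun_eq_iff indicator_def)
    then show ?thesis by (simp only: Bochner_Integration.integral_minus)
  qed
  finally have le: "(\<integral>\<xi>. indicator A \<xi> * (- g \<xi>) \<partial>\<mu>) \<le> 0" by simp
  have nn: "AE \<xi> in \<mu>. 0 \<le> indicator A \<xi> * (- g \<xi>)"
    by (intro AE_I2) (auto simp: A_def indicator_def)
  have int: "integrable \<mu> (\<lambda>\<xi>. indicator A \<xi> * (- g \<xi>))"
    using A g by (intro integrable_mult_indicator[where 'b=real, simplified]) auto
  have "(\<integral>\<xi>. indicator A \<xi> * (- g \<xi>) \<partial>\<mu>) = 0"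
    using le integral_nonneg_AE[OF nn] by simp
  then have "AE \<xi> in \<mu>. indicator A \<xi> * (- g \<xi>) = 0"
    using integral_nonneg_eq_0_iff_AE[OF int nn] by simp
  then show ?thesis
    by (rule AE_mp) (auto intro!: AE_I2 simp: A_def indicator_def)
qed

end

section \<open>The Fourier transform\<close>

text \<open>Makes the L2 lemmas applicable to \<open>ell2\<close>, as the case of counting
  measure.\<close>

lemma infsum_eq_integral_count_space:
  fixes f :: "'a \<Rightarrow> real"
  assumes "\<And>x. 0 \<le> f x"
  shows "infsum f UNIV = (\<integral>x. f x \<partial>count_space UNIV)"
    and summable_on_iff_integrable: "f summable_on UNIV \<longleftrightarrow> integrable (count_space UNIV) f"
proof -
  show iff: "f summable_on UNIV \<longleftrightarrow> integrable (count_space UNIV) f"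
    using abs_summable_equivalent[of f UNIV] assms by (simp add: Infinite_Set_Sum.abs_summable_on_def)
  show "infsum f UNIV = (\<integral>x. f x \<partial>count_space UNIV)"
  proof (cases "f summable_on UNIV")
    case True
    then show ?thesis
      using infsetsum_infsum[of f UNIV] iff
      by (simp add: infsetsum_def Infinite_Set_Sum.abs_summable_on_def)
  next
    case False
    then show ?thesis using iff by (simp add: infsum_not_exists not_integrable_integral_eq)
  qed
qed

lemma ell2_iff_L2_fun: "a \<in> ell2 \<longleftrightarrow> L2_fun (count_space UNIV) a"
  by (simp add: ell2_def L2_fun_def summable_on_iff_integrable)

lemma ell2_norm_sq: "(ell2_norm a)\<^sup>2 = sq_integral (count_space UNIV) a"
  unfolding ell2_norm_def sq_integral_def
  by (subst real_sqrt_pow2) (simp_all add: infsum_nonneg infsum_eq_integral_count_space)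

lemma ell1_iff_integrable: "a \<in> ell1 \<longleftrightarrow> integrable (count_space UNIV) (\<lambda>x. cmod (a x))"
  by (simp add: ell1_def summable_on_iff_integrable)

lemma ell2_reindex:
  assumes "a \<in> ell2" "inj \<pi>"
  shows "(\<lambda>x. a (\<pi> x)) \<in> ell2"
proof -
  have "(\<lambda>x. (cmod (a x))\<^sup>2) summable_on range \<pi>"
    using assms(1) by (auto simp: ell2_def intro: summable_on_subset_banach)
  then show ?thesis
    using summable_on_reindex[OF assms(2), of "\<lambda>x. (cmod (a x))\<^sup>2"] by (simp add: ell2_def comp_def)
qed

lemma sq_integral_reindex:
  assumes "bij \<pi>"
  shows "sq_integral (count_space UNIV) (\<lambda>x. a (\<pi> x)) = sq_integral (count_space UNIV) a"
proof -
  have "sq_integral (count_space UNIV) a = (\<integral>x. (cmod (a x))\<^sup>2 \<partial>(distr (count_space UNIV) (count_space UNIV) \<pi>))"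
    using assms by (simp add: sq_integral_def distr_bij_count_space)
  also have "\<dots> = sq_integral (count_space UNIV) (\<lambda>x. a (\<pi> x))"
    by (subst integral_distr) (auto simp: sq_integral_def)
  finally show ?thesis by simp
qed

lemma integral_count_space_finite:
  fixes f :: "'a \<Rightarrow> 'b::{banach, second_countable_topology}"
  assumes "finite S" "\<And>x. x \<notin> S \<Longrightarrow> f x = 0"
  shows "(\<integral>x. f x \<partial>count_space UNIV) = (\<Sum>x\<in>S. f x)"
    and integrable_count_space_finite: "integrable (count_space UNIV) f"
proof -
  have sub: "{x. f x \<noteq> 0} \<subseteq> S" using assms(2) by blast
  then have fin: "finite {x. f x \<noteq> 0}" using assms(1) finite_subset by blast
  then have "(\<integral>x. f x \<partial>count_space UNIV) = (\<Sum>x | f x \<noteq> 0. f x)"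
    by (subst lebesgue_integral_count_space_finite_support) auto
  also have "\<dots> = (\<Sum>x\<in>S. f x)"
    using assms sub by (intro sum.mono_neutral_left) auto
  finally show "(\<integral>x. f x \<partial>count_space UNIV) = (\<Sum>x\<in>S. f x)" .
  have "(\<lambda>x. norm (f x)) summable_on UNIV"
    by (rule summable_on_cong_neutral[THEN iffD1, OF _ _ _ summable_on_finite[OF assms(1)]])
      (use assms(2) in auto)
  then show "integrable (count_space UNIV) f"
    using summable_on_iff_integrable[of "\<lambda>x. norm (f x)"] by (simp add: integrable_norm_iff)
qed

lemma count_space_tail_small:
  fixes f :: "'a \<Rightarrow> real"
  assumes f: "integrable (count_space UNIV) f" "\<And>x. 0 \<le> f x" and e: "e > 0"
  obtains S where "finite S" "(\<integral>x. (if x \<in> S then 0 else f x) \<partial>count_space UNIV) < e"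
proof -
  have "f summable_on UNIV" using summable_on_iff_integrable[of f] f by simp
  then have "(f has_sum infsum f UNIV) UNIV" by (rule has_sum_infsum)
  then have "\<forall>\<^sub>F S in finite_subsets_at_top UNIV. dist (sum f S) (infsum f UNIV) < e"
    using e by (auto simp: has_sum_def dest: tendstoD)
  then obtain S where S: "finite S" "dist (sum f S) (infsum f UNIV) < e"
    by (auto simp: eventually_finite_subsets_at_top)
  have "(\<integral>x. f x \<partial>count_space UNIV) = (\<integral>x. (if x \<in> S then f x else 0) + (if x \<in> S then 0 else f x) \<partial>count_space UNIV)"
    by (rule Bochner_Integration.integral_cong) auto
  also have "\<dots> = (\<integral>x. (if x \<in> S then f x else 0) \<partial>count_space UNIV) + (\<integral>x. (if x \<in> S then 0 else f x) \<partial>count_space UNIV)"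
    by (intro Bochner_Integration.integral_add Bochner_Integration.integrable_bound[OF f(1)] AE_I2) auto
  also have "(\<integral>x. (if x \<in> S then f x else 0) \<partial>count_space UNIV) = sum f S"
    by (subst integral_count_space_finite[OF S(1)]) auto
  finally have "(\<integral>x. (if x \<in> S then 0 else f x) \<partial>count_space UNIV) < e"
    using S(2) infsum_eq_integral_count_space[of f] f(2) by (simp add: dist_real_def)
  with S(1) that show thesis by blast
qed

lemma finite_support_L2:
  assumes "finite {n. b n \<noteq> 0}"
  shows "L2_fun (count_space UNIV) b"
  unfolding L2_fun_def using assms
  by (auto intro!: integrable_count_space_finite[of "{n. b n \<noteq> 0}"])

lemma finite_support_ell1: "finite {n. b n \<noteq> 0} \<Longrightarrow> b \<in> ell1"
  unfolding ell1_iff_integrable by (auto intro!: integrable_count_space_finite[of "{n. b n \<noteq> 0}"])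

lemma sq_integral_finite_support:
  assumes "finite S" "\<And>n. n \<notin> S \<Longrightarrow> b n = 0"
  shows "sq_integral (count_space UNIV) b = (\<Sum>n\<in>S. (cmod (b n))\<^sup>2)"
  unfolding sq_integral_def using assms by (intro integral_count_space_finite) auto

text \<open>The index set may be uncountable, so the truncations follow no enumeration: for each k a
  finite set with tail below 1/(k+1) is chosen.\<close>

lemma ell2_truncation:
  assumes a: "L2_fun (count_space UNIV) a"
  obtains b :: "nat \<Rightarrow> 'a \<Rightarrow> complex" where "\<And>k. finite {n. b k n \<noteq> 0}" "L2_tendsto (count_space UNIV) b a"
proof -
  have "\<exists>S. finite S \<and> (\<integral>x. (if x \<in> S then 0 else (cmod (a x))\<^sup>2) \<partial>count_space UNIV) < inverse (real (Suc k))" for k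
    by (rule count_space_tail_small[OF L2_fun_integrable[OF a], of "inverse (real (Suc k))"]) auto
  then obtain S where S: "\<And>k. finite (S k)"
    "\<And>k. (\<integral>x. (if x \<in> S k then 0 else (cmod (a x))\<^sup>2) \<partial>count_space UNIV) < inverse (real (Suc k))"
    by metis
  define b where "b k n = (if n \<in> S k then a n else 0)" for k n
  have fin: "finite {n. b k n \<noteq> 0}" for k
    by (rule finite_subset[OF _ S(1)[of k]]) (auto simp: b_def)
  have "sq_integral (count_space UNIV) (\<lambda>n. b k n - a n) \<le> inverse (real (Suc k))" for k
  proof -
    have "sq_integral (count_space UNIV) (\<lambda>n. b k n - a n)
        = (\<integral>x. (if x \<in> S k then 0 else (cmod (a x))\<^sup>2) \<partial>count_space UNIV)"
      unfolding sq_integral_def by (rule Bochner_Integration.integral_cong) (auto simp: b_def)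
    with S(2)[of k] show ?thesis by simp
  qed
  then have "L2_tendsto (count_space UNIV) b a"
    by (rule L2_tendstoI[OF finite_support_L2[OF fin] a _ LIMSEQ_inverse_real_of_nat])
  with fin that show thesis by blast
qed

section \<open>Transforms of finitely supported sequences\<close>

lemma fourier_finite_support:
  assumes "finite S" "\<And>n. n \<notin> S \<Longrightarrow> b n = 0"
  shows "fourier_ell1 b \<xi> = (\<Sum>n\<in>S. b n * \<xi> (- n))"
proof -
  have "fourier_ell1 b \<xi> = infsum (\<lambda>n. b n * \<xi> (- n)) S"
    unfolding fourier_ell1_def using assms(2) by (intro infsum_cong_neutral) auto
  then show ?thesis using assms(1) by simp
qed

lemma fourier_finite_support_add:
  assumes "finite {n. b n \<noteq> 0}" "finite {n. c n \<noteq> 0}"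
  shows "fourier_ell1 (\<lambda>n. b n + c n) \<xi> = fourier_ell1 b \<xi> + fourier_ell1 c \<xi>"
proof -
  let ?S = "{n. b n \<noteq> 0} \<union> {n. c n \<noteq> 0}"
  have "finite ?S" using assms by simp
  then show ?thesis
    by (subst (1 2 3) fourier_finite_support[of ?S]) (auto simp: sum.distrib distrib_right)
qed

lemma fourier_cmult: "fourier_ell1 (\<lambda>n. c * b n) \<xi> = c * fourier_ell1 b \<xi>"
  by (simp add: fourier_ell1_def infsum_cmult_right' mult.assoc)

lemma fourier_finite_support_shift:
  assumes "finite {n. b n \<noteq> 0}" "\<xi> \<in> dual_group"
  shows "fourier_ell1 (\<lambda>m. b (m - n)) \<xi> = \<xi> (- n) * fourier_ell1 b \<xi>"
proof -
  let ?S = "{n. b n \<noteq> 0}"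
  have inj: "inj_on (\<lambda>m. m + n) ?S" by (simp add: inj_on_def)
  have "fourier_ell1 (\<lambda>m. b (m - n)) \<xi> = (\<Sum>m\<in>(\<lambda>m. m + n) ` ?S. b (m - n) * \<xi> (- m))"
  proof (rule fourier_finite_support)
    show "b (m - n) = 0" if "m \<notin> (\<lambda>m. m + n) ` ?S" for m
      using that image_eqI[of m "\<lambda>m. m + n" "m - n" ?S] by auto
  qed (use assms(1) in auto)
  also have "\<dots> = (\<Sum>m\<in>?S. b m * \<xi> (- n + - m))"
    by (subst sum.reindex[OF inj]) (simp add: algebra_simps)
  also have "\<dots> = \<xi> (- n) * fourier_ell1 b \<xi>"
    using assms(1) unfolding dual_group_add[OF assms(2)]
    by (subst fourier_finite_support[of ?S]) (auto simp: sum_distrib_left mult_ac)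
  finally show ?thesis .
qed

text \<open>Agreement on the space is enough: identities between transforms that use the character
  law hold on the dual group only.\<close>

lemma L2_tendsto_cong:
  assumes "L2_tendsto M u v" "\<And>k x. x \<in> space M \<Longrightarrow> u' k x = u k x" "\<And>x. x \<in> space M \<Longrightarrow> v' x = v x"
  shows "L2_tendsto M u' v'"
proof -
  have "L2_fun M (u' k) \<longleftrightarrow> L2_fun M (u k)" for k
    unfolding L2_fun_def using assms(2)
    by (intro arg_cong2[of _ _ _ _ "(\<and>)"] measurable_cong Bochner_Integration.integrable_cong) auto
  moreover have "L2_fun M v' \<longleftrightarrow> L2_fun M v"
    unfolding L2_fun_def using assms(3)
    by (intro arg_cong2[of _ _ _ _ "(\<and>)"] measurable_cong Bochner_Integration.integrable_cong) auto
  moreover have "sq_integral M (\<lambda>x. u' k x - v' x) = sq_integral M (\<lambda>x. u k x - v x)" for k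
    unfolding sq_integral_def using assms(2,3) by (intro Bochner_Integration.integral_cong) auto
  ultimately show ?thesis using assms(1) by (simp add: L2_tendsto_def)
qed

lemma L2_tendsto_reindex:
  assumes "L2_tendsto (count_space UNIV) u v" "bij \<pi>"
  shows "L2_tendsto (count_space UNIV) (\<lambda>k x. u k (\<pi> x)) (\<lambda>x. v (\<pi> x))"
proof (rule L2_tendstoI)
  note u = L2_tendstoD[OF assms(1)]
  have *: "L2_fun (count_space UNIV) (\<lambda>x. a (\<pi> x))" if "L2_fun (count_space UNIV) a" for a
    using that ell2_reindex bij_is_inj[OF assms(2)] by (simp flip: ell2_iff_L2_fun)
  show "L2_fun (count_space UNIV) (\<lambda>x. u k (\<pi> x))" for k by (rule *) (rule u)
  show "L2_fun (count_space UNIV) (\<lambda>x. v (\<pi> x))" by (rule *) (rule u)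
  show "sq_integral (count_space UNIV) (\<lambda>x. u k (\<pi> x) - v (\<pi> x)) \<le> sq_integral (count_space UNIV) (\<lambda>x. u k x - v x)" for k
    by (simp add: sq_integral_reindex[OF assms(2), of "\<lambda>x. u k x - v x"])
qed (rule L2_tendsto_lim[OF assms(1)])

context dual_haar
begin

text \<open>
  \<open>fourier_pair a g\<close> is the transform defined through one sequence of finitely supported
  approximants; it turns out to coincide with \<open>is_fourier\<close> on \<open>\<ell>\<^sup>2\<close>.
\<close>

definition fourier_pair :: "('n \<Rightarrow> complex) \<Rightarrow> (('n \<Rightarrow> complex) \<Rightarrow> complex) \<Rightarrow> bool" where
  "fourier_pair a g \<longleftrightarrow> (\<exists>b :: nat \<Rightarrow> 'n \<Rightarrow> complex. (\<forall>k. finite {n. b k n \<noteq> 0}) \<and>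
     L2_tendsto (count_space UNIV) b a \<and> L2_tendsto \<mu> (\<lambda>k. fourier_ell1 (b k)) g)"

lemma fourier_pairE:
  assumes "fourier_pair a g"
  obtains b :: "nat \<Rightarrow> 'n \<Rightarrow> complex" where "\<And>k. finite {n. b k n \<noteq> 0}"
    "L2_tendsto (count_space UNIV) b a" "L2_tendsto \<mu> (\<lambda>k. fourier_ell1 (b k)) g"
  using assms unfolding fourier_pair_def by blast

lemma fourier_pairI:
  "(\<And>k. finite {n. b k n \<noteq> 0}) \<Longrightarrow> L2_tendsto (count_space UNIV) b a \<Longrightarrow>
   L2_tendsto \<mu> (\<lambda>k. fourier_ell1 (b k)) g \<Longrightarrow> fourier_pair a g" for b :: "nat \<Rightarrow> 'n \<Rightarrow> complex"
  unfolding fourier_pair_def by blast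

lemma fourier_pair_L2:
  assumes "fourier_pair a g"
  shows "L2_fun (count_space UNIV) a" "L2_fun \<mu> g"
  using assms by (auto elim!: fourier_pairE dest: L2_tendsto_limit)

lemma trig_poly_fourier:
  assumes "finite {n. b n \<noteq> 0}"
  shows "trig_poly (fourier_ell1 b)"
  using assms by (intro trig_polyI[of "{n. b n \<noteq> 0}" _ b] fourier_finite_support) auto

lemma parseval_finite_support:
  assumes "finite {n. b n \<noteq> 0}"
  shows "sq_integral \<mu> (fourier_ell1 b) = sq_integral (count_space UNIV) b"
proof -
  let ?S = "{n. b n \<noteq> 0}"
  have "fourier_ell1 b = (\<lambda>\<xi>. \<Sum>n\<in>?S. b n * \<xi> (- n))"
    using assms by (intro ext fourier_finite_support) auto
  then show ?thesis
    using sq_integral_trig_poly[OF assms, of b] sq_integral_finite_support[OF assms, of b] by simp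
qed

lemma fourier_pair_parseval:
  assumes "fourier_pair a g"
  shows "sq_integral \<mu> g = sq_integral (count_space UNIV) a"
proof -
  obtain b where b: "\<And>k. finite {n. b k n \<noteq> 0}"
    "L2_tendsto (count_space UNIV) b a" "L2_tendsto \<mu> (\<lambda>k. fourier_ell1 (b k)) g"
    using fourier_pairE[OF assms] by blast
  show ?thesis
    using sq_integral_tendsto[OF b(2)] sq_integral_tendsto[OF b(3)]
    by (simp add: parseval_finite_support[OF b(1)] LIMSEQ_unique)
qed

lemma fourier_pair_add:
  assumes "fourier_pair a g" "fourier_pair a' g'"
  shows "fourier_pair (\<lambda>n. a n + a' n) (\<lambda>\<xi>. g \<xi> + g' \<xi>)"
proof -
  obtain b where b: "\<And>k. finite {n. b k n \<noteq> 0}"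
    "L2_tendsto (count_space UNIV) b a" "L2_tendsto \<mu> (\<lambda>k. fourier_ell1 (b k)) g"
    using fourier_pairE[OF assms(1)] by blast
  obtain b' where b': "\<And>k. finite {n. b' k n \<noteq> 0}"
    "L2_tendsto (count_space UNIV) b' a'" "L2_tendsto \<mu> (\<lambda>k. fourier_ell1 (b' k)) g'"
    using fourier_pairE[OF assms(2)] by blast
  show ?thesis
  proof (rule fourier_pairI)
    show "finite {n. b k n + b' k n \<noteq> 0}" for k
      by (rule finite_subset[of _ "{n. b k n \<noteq> 0} \<union> {n. b' k n \<noteq> 0}"]) (use b(1) b'(1) in auto)
    show "L2_tendsto \<mu> (\<lambda>k. fourier_ell1 (\<lambda>n. b k n + b' k n)) (\<lambda>\<xi>. g \<xi> + g' \<xi>)"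
      using L2_tendsto_add[OF b(3) b'(3)] by (rule L2_tendsto_cong) (simp_all add: fourier_finite_support_add b(1) b'(1))
  qed (rule L2_tendsto_add[OF b(2) b'(2)])
qed

lemma fourier_pair_cmult:
  assumes "fourier_pair a g"
  shows "fourier_pair (\<lambda>n. c * a n) (\<lambda>\<xi>. c * g \<xi>)"
proof -
  obtain b where b: "\<And>k. finite {n. b k n \<noteq> 0}"
    "L2_tendsto (count_space UNIV) b a" "L2_tendsto \<mu> (\<lambda>k. fourier_ell1 (b k)) g"
    using fourier_pairE[OF assms(1)] by blast
  show ?thesis
  proof (rule fourier_pairI)
    show "finite {n. c * b k n \<noteq> 0}" for k
      by (rule finite_subset[OF _ b(1)[of k]]) auto
    show "L2_tendsto \<mu> (\<lambda>k. fourier_ell1 (\<lambda>n. c * b k n)) (\<lambda>\<xi>. c * g \<xi>)"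
      using L2_tendsto_cmult[OF b(3), of c] by (rule L2_tendsto_cong) (simp_all add: fourier_cmult)
  qed (rule L2_tendsto_cmult[OF b(2)])
qed

lemma fourier_pair_diff:
  assumes "fourier_pair a g" "fourier_pair a' g'"
  shows "fourier_pair (\<lambda>n. a n - a' n) (\<lambda>\<xi>. g \<xi> - g' \<xi>)"
  using fourier_pair_add[OF assms(1) fourier_pair_cmult[OF assms(2), of "-1"]] by simp

lemma fourier_pair_shift:
  assumes "fourier_pair a g"
  shows "fourier_pair (\<lambda>m. a (m - n)) (\<lambda>\<xi>. \<xi> (- n) * g \<xi>)"
proof -
  obtain b where b: "\<And>k. finite {n. b k n \<noteq> 0}"
    "L2_tendsto (count_space UNIV) b a" "L2_tendsto \<mu> (\<lambda>k. fourier_ell1 (b k)) g"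
    using fourier_pairE[OF assms(1)] by blast
  have bij: "bij (\<lambda>m. m - n)"
    by (rule bij_betw_byWitness[of _ "\<lambda>m. m + n"]) auto
  show ?thesis
  proof (rule fourier_pairI)
    show "finite {m. b k (m - n) \<noteq> 0}" for k
      using finite_vimageI[OF b(1)[of k] bij_is_inj[OF bij]] by (simp add: vimage_def)
    show "L2_tendsto (count_space UNIV) (\<lambda>k m. b k (m - n)) (\<lambda>m. a (m - n))"
      by (rule L2_tendsto_reindex[OF b(2) bij])
    have "AE \<xi> in \<mu>. cmod (\<xi> (- n)) \<le> 1"
      by (intro AE_I2) (simp add: space_mu dual_group_norm)
    from L2_tendsto_mult_bounded[OF b(3) character_measurable this]
    show "L2_tendsto \<mu> (\<lambda>k. fourier_ell1 (\<lambda>m. b k (m - n))) (\<lambda>\<xi>. \<xi> (- n) * g \<xi>)"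
      by (rule L2_tendsto_cong) (simp_all add: space_mu fourier_finite_support_shift b(1))
  qed
qed

lemma fourier_pair_zero: "fourier_pair (\<lambda>_. 0) (\<lambda>_. 0)"
  by (rule fourier_pairI[of "\<lambda>_ _. 0"])
    (simp_all add: fourier_ell1_def[abs_def] L2_tendsto_def L2_fun_zero sq_integral_def)

lemma fourier_pair_sum:
  "(\<And>i. i \<in> I \<Longrightarrow> fourier_pair (a i) (g i)) \<Longrightarrow> fourier_pair (\<lambda>n. \<Sum>i\<in>I. a i n) (\<lambda>\<xi>. \<Sum>i\<in>I. g i \<xi>)"
  by (induction I rule: infinite_finite_induct) (auto intro: fourier_pair_add fourier_pair_zero)

text \<open>The transform is isometric on finite supports, so it maps truncations to a Cauchy
  sequence.\<close>

lemma fourier_pair_exists: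
  assumes a: "L2_fun (count_space UNIV) a"
  obtains g where "fourier_pair a g"
proof -
  obtain b :: "nat \<Rightarrow> 'n \<Rightarrow> complex" where b: "\<And>k. finite {n. b k n \<noteq> 0}" "L2_tendsto (count_space UNIV) b a"
    using ell2_truncation[OF a] by blast
  note L2b = L2_tendsto_fun[OF b(2)]
  have dist: "sq_integral \<mu> (\<lambda>\<xi>. fourier_ell1 (b j) \<xi> - fourier_ell1 (b k) \<xi>)
      = sq_integral (count_space UNIV) (\<lambda>n. b j n - b k n)" for j k
  proof -
    have fin: "finite {n. (-1) * b k n \<noteq> 0}" "finite {n. b j n - b k n \<noteq> 0}"
      by (rule finite_subset[of _ "{n. b j n \<noteq> 0} \<union> {n. b k n \<noteq> 0}"]; use b(1) in auto)+
    have "fourier_ell1 (\<lambda>n. b j n - b k n) = (\<lambda>\<xi>. fourier_ell1 (b j) \<xi> - fourier_ell1 (b k) \<xi>)"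
      using fourier_finite_support_add[OF b(1)[of j] fin(1)] fourier_cmult[of "-1" "b k"] by (simp add: fun_eq_iff)
    then show ?thesis using parseval_finite_support[OF fin(2)] by simp
  qed
  obtain g where g: "L2_tendsto \<mu> (\<lambda>k. fourier_ell1 (b k)) g"
  proof (rule Riesz_Fischer[of \<mu> "\<lambda>k. fourier_ell1 (b k)"])
    show "finite_measure \<mu>" by unfold_locales
    show "L2_fun \<mu> (fourier_ell1 (b k))" for k
      by (rule L2_fun_trig_poly[OF trig_poly_fourier[OF b(1)]])
  next
    fix e :: real assume e: "e > 0"
    then obtain K where K: "\<And>k. k \<ge> K \<Longrightarrow> sq_integral (count_space UNIV) (\<lambda>n. b k n - a n) < e / 4"
      using LIMSEQ_D[OF L2_tendsto_lim[OF b(2)], of "e / 4"] by auto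
    have "sq_integral (count_space UNIV) (\<lambda>n. b j n - b k n) < e" if "j \<ge> K" "k \<ge> K" for j k
      using sq_integral_triangle[OF L2b[of j] a L2b[of k]] K[OF that(1)] K[OF that(2)]
      by (simp add: sq_integral_diff_commute[of _ a])
    then show "\<exists>K. \<forall>j\<ge>K. \<forall>k\<ge>K. sq_integral \<mu> (\<lambda>\<xi>. fourier_ell1 (b j) \<xi> - fourier_ell1 (b k) \<xi>) < e"
      unfolding dist by blast
  qed
  from fourier_pairI[OF b g] that show thesis by blast
qed

text \<open>Reconciles the explicit series with the L2 limit: one summable tail e k dominates the
  squared \<open>ell2\<close> error through (e k)^2 and the transforms uniformly, so both limits
  exist along the same truncations.\<close>

lemma fourier_pair_ell1:
  assumes a: "a \<in> ell1"
  shows "fourier_pair a (fourier_ell1 a)"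
proof -
  note int = a[unfolded ell1_iff_integrable]
  have "\<exists>S. finite S \<and> (\<integral>x. (if x \<in> S then 0 else cmod (a x)) \<partial>count_space UNIV) < inverse (real (Suc k))" for k
    by (rule count_space_tail_small[OF int, of "inverse (real (Suc k))"]) auto
  then obtain S where S: "\<And>k. finite (S k)"
    "\<And>k. (\<integral>x. (if x \<in> S k then 0 else cmod (a x)) \<partial>count_space UNIV) < inverse (real (Suc k))"
    by metis
  define b where "b k n = (if n \<in> S k then a n else 0)" for k n
  define e where "e k = (\<integral>x. (if x \<in> S k then 0 else cmod (a x)) \<partial>count_space UNIV)" for k
  have e: "0 \<le> e k" "e k < inverse (real (Suc k))" for k
    using S(2)[of k] by (auto simp: e_def)
  have fin: "finite {n. b k n \<noteq> 0}" for k
    by (rule finite_subset[OF _ S(1)[of k]]) (auto simp: b_def)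
  have diff_int: "integrable (count_space UNIV) (\<lambda>x. cmod (b k x - a x))" for k
    by (rule Bochner_Integration.integrable_bound[OF int]) (auto simp: b_def intro!: AE_I2)
  have diff_eq: "(\<integral>x. cmod (b k x - a x) \<partial>count_space UNIV) = e k" for k
    unfolding e_def by (rule Bochner_Integration.integral_cong) (auto simp: b_def)
  have e_lim: "e \<longlonglongrightarrow> 0"
    by (rule tendsto_sandwich[OF _ _ tendsto_const LIMSEQ_inverse_real_of_nat])
      (use e in \<open>auto intro!: always_eventually less_imp_le simp del: of_nat_Suc\<close>)
  have e2_lim: "(\<lambda>k. (e k)\<^sup>2) \<longlonglongrightarrow> 0"
    using tendsto_power[OF e_lim, of 2] by simp
  \<comment> \<open>A single term of a nonnegative sum is at most the sum; hence the squared error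
    is at most e k times the error.\<close>
  have pointwise: "cmod (b k x - a x) \<le> e k" for k x
  proof -
    have "(\<integral>y. (if y = x then cmod (b k x - a x) else 0) \<partial>count_space UNIV) \<le> (\<integral>y. cmod (b k y - a y) \<partial>count_space UNIV)"
      by (intro integral_mono diff_int integrable_count_space_finite[of "{x}"]) auto
    then show ?thesis
      using integral_count_space_finite[of "{x}" "\<lambda>y. if y = x then cmod (b k x - a x) else 0"]
      by (simp add: diff_eq)
  qed
  have sq_int: "integrable (count_space UNIV) (\<lambda>x. (cmod (b k x - a x))\<^sup>2)" for k
    by (rule Bochner_Integration.integrable_bound[OF integrable_mult_right[OF diff_int[of k], of "e k"]])
      (auto simp: power2_eq_square abs_mult intro!: AE_I2 mult_mono order_trans[OF pointwise abs_ge_self])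
  have L2_diff: "L2_fun (count_space UNIV) (\<lambda>x. b k x - a x)" for k
    by (simp add: L2_fun_def sq_int)
  have L2_a: "L2_fun (count_space UNIV) a"
    using L2_fun_diff[OF finite_support_L2[OF fin[of 0]] L2_diff[of 0]] by simp
  have "L2_tendsto (count_space UNIV) b a"
  proof (rule L2_tendstoI[OF finite_support_L2[OF fin] L2_a _ e2_lim])
    fix k
    have "sq_integral (count_space UNIV) (\<lambda>x. b k x - a x) \<le> (\<integral>x. e k * cmod (b k x - a x) \<partial>count_space UNIV)"
      unfolding sq_integral_def
      by (intro integral_mono sq_int integrable_mult_right diff_int)
        (auto simp: power2_eq_square intro!: mult_right_mono pointwise)
    also have "\<dots> = (e k)\<^sup>2" by (simp add: diff_eq power2_eq_square)
    finally show "sq_integral (count_space UNIV) (\<lambda>x. b k x - a x) \<le> (e k)\<^sup>2" .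
  qed
  moreover have unif: "cmod (fourier_ell1 (b k) \<xi> - fourier_ell1 a \<xi>) \<le> e k" if \<xi>: "\<xi> \<in> dual_group" for k \<xi>
  proof -
    have sum_a: "(\<lambda>n. a n * \<xi> (- n)) summable_on UNIV"
      by (rule abs_summable_summable) (use a in \<open>simp add: ell1_def norm_mult dual_group_norm[OF \<xi>]\<close>)
    have sum_b: "(\<lambda>n. b k n * \<xi> (- n)) summable_on UNIV"
      by (rule abs_summable_summable)
        (use finite_support_ell1[OF fin[of k]] in \<open>simp add: ell1_def norm_mult dual_group_norm[OF \<xi>]\<close>)
    have "fourier_ell1 (b k) \<xi> - fourier_ell1 a \<xi> = infsum (\<lambda>n. (b k n - a n) * \<xi> (- n)) UNIV"
      using infsum_add[OF sum_b summable_on_uminus[THEN iffD2, OF sum_a]]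
      by (simp add: fourier_ell1_def left_diff_distrib infsum_uminus)
    also have "cmod \<dots> \<le> infsum (\<lambda>n. cmod ((b k n - a n) * \<xi> (- n))) UNIV"
      using diff_int[of k]
      by (intro norm_infsum_bound) (simp add: norm_mult dual_group_norm[OF \<xi>] summable_on_iff_integrable)
    also have "\<dots> = e k"
      by (simp add: norm_mult dual_group_norm[OF \<xi>] infsum_eq_integral_count_space diff_eq)
    finally show ?thesis .
  qed
  have meas_b: "fourier_ell1 (b k) \<in> borel_measurable \<mu>" for k
    by (rule trig_poly_measurable[OF trig_poly_fourier[OF fin]])
  have meas: "fourier_ell1 a \<in> borel_measurable \<mu>"
  proof (rule borel_measurable_LIMSEQ_metric[OF meas_b])
    fix \<xi> assume "\<xi> \<in> space \<mu>"
    then have \<xi>: "\<xi> \<in> dual_group" by (simp add: space_mu)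
    have "(\<lambda>k. fourier_ell1 (b k) \<xi> - fourier_ell1 a \<xi>) \<longlonglongrightarrow> 0"
      by (rule Lim_null_comparison[OF _ e_lim]) (simp add: unif[OF \<xi>])
    then show "(\<lambda>k. fourier_ell1 (b k) \<xi>) \<longlonglongrightarrow> fourier_ell1 a \<xi>" by (simp add: LIM_zero_iff)
  qed
  have sq_le: "AE \<xi> in \<mu>. (cmod (fourier_ell1 (b k) \<xi> - fourier_ell1 a \<xi>))\<^sup>2 \<le> (e k)\<^sup>2" for k
    by (intro AE_I2 power_mono unif) (auto simp: space_mu)
  have int_mu: "integrable \<mu> (\<lambda>\<xi>. (cmod (fourier_ell1 (b k) \<xi> - fourier_ell1 a \<xi>))\<^sup>2)" for k
    using sq_le[of k] meas meas_b by (intro integrable_const_bound[of _ "(e k)\<^sup>2"]) auto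
  have "L2_tendsto \<mu> (\<lambda>k. fourier_ell1 (b k)) (fourier_ell1 a)"
  proof (rule L2_tendstoI[OF _ _ _ e2_lim])
    show L2: "L2_fun \<mu> (fourier_ell1 (b k))" for k
      by (rule L2_fun_trig_poly[OF trig_poly_fourier[OF fin]])
    have "L2_fun \<mu> (\<lambda>\<xi>. fourier_ell1 (b 0) \<xi> - fourier_ell1 a \<xi>)"
      using int_mu meas meas_b by (simp add: L2_fun_def)
    from L2_fun_diff[OF L2[of 0] this] show "L2_fun \<mu> (fourier_ell1 a)" by simp
    show "sq_integral \<mu> (\<lambda>\<xi>. fourier_ell1 (b k) \<xi> - fourier_ell1 a \<xi>) \<le> (e k)\<^sup>2" for k
      unfolding sq_integral_def by (rule integral_le_const[OF int_mu sq_le])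
  qed
  ultimately show ?thesis by (rule fourier_pairI[OF fin])
qed

text \<open>By linearity and Parseval, the distance of the transform of any summable b k from g
  equals the distance of b k from a.\<close>

lemma fourier_pair_imp_is_fourier:
  assumes "fourier_pair a g"
  shows "is_fourier \<mu> a g"
  unfolding is_fourier_def
proof (intro conjI allI impI)
  show "L2_fun \<mu> g" by (rule fourier_pair_L2[OF assms])
  fix b :: "nat \<Rightarrow> 'n \<Rightarrow> complex"
  assume b: "(\<forall>k. b k \<in> ell1) \<and> (\<lambda>k. ell2_norm (\<lambda>n. b k n - a n)) \<longlonglongrightarrow> 0"
  have "(\<integral>\<^sup>+\<xi>. ennreal ((cmod (fourier_ell1 (b k) \<xi> - g \<xi>))\<^sup>2) \<partial>\<mu>) = ennreal ((ell2_norm (\<lambda>n. b k n - a n))\<^sup>2)" for k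
  proof -
    have pair: "fourier_pair (\<lambda>n. b k n - a n) (\<lambda>\<xi>. fourier_ell1 (b k) \<xi> - g \<xi>)"
      using b by (intro fourier_pair_diff fourier_pair_ell1 assms) auto
    show ?thesis
      using nn_integral_sq_eq[OF fourier_pair_L2(2)[OF pair]] fourier_pair_parseval[OF pair]
      by (simp add: ell2_norm_sq)
  qed
  moreover have "(\<lambda>k. ennreal ((ell2_norm (\<lambda>n. b k n - a n))\<^sup>2)) \<longlonglongrightarrow> ennreal (0\<^sup>2)"
    using b by (intro tendsto_intros) auto
  ultimately show "(\<lambda>k. \<integral>\<^sup>+\<xi>. ennreal ((cmod (fourier_ell1 (b k) \<xi> - g \<xi>))\<^sup>2) \<partial>\<mu>) \<longlonglongrightarrow> 0"
    by simp
qed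

lemma is_fourier_imp_fourier_pair:
  assumes a: "a \<in> ell2" and g: "is_fourier \<mu> a g"
  shows "fourier_pair a g"
proof -
  obtain b :: "nat \<Rightarrow> 'n \<Rightarrow> complex" where b: "\<And>k. finite {n. b k n \<noteq> 0}" "L2_tendsto (count_space UNIV) b a"
    using ell2_truncation a by (auto simp: ell2_iff_L2_fun)
  have L2g: "L2_fun \<mu> g" using g by (simp add: is_fourier_def)
  have L2b: "L2_fun \<mu> (fourier_ell1 (b k))" for k
    by (rule L2_fun_trig_poly[OF trig_poly_fourier[OF b(1)]])
  have "(\<lambda>k. sqrt ((ell2_norm (\<lambda>n. b k n - a n))\<^sup>2)) \<longlonglongrightarrow> sqrt 0"
    unfolding ell2_norm_sq by (intro tendsto_real_sqrt L2_tendsto_lim[OF b(2)])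
  then have "(\<lambda>k. ell2_norm (\<lambda>n. b k n - a n)) \<longlonglongrightarrow> 0"
    by (simp add: ell2_norm_def infsum_nonneg)
  then have "(\<lambda>k. \<integral>\<^sup>+\<xi>. ennreal ((cmod (fourier_ell1 (b k) \<xi> - g \<xi>))\<^sup>2) \<partial>\<mu>) \<longlonglongrightarrow> 0"
    using g b(1) finite_support_ell1 unfolding is_fourier_def by blast
  then have "(\<lambda>k. ennreal (sq_integral \<mu> (\<lambda>\<xi>. fourier_ell1 (b k) \<xi> - g \<xi>))) \<longlonglongrightarrow> ennreal 0"
    by (simp add: nn_integral_sq_eq L2_fun_diff L2b L2g)
  then have "(\<lambda>k. sq_integral \<mu> (\<lambda>\<xi>. fourier_ell1 (b k) \<xi> - g \<xi>)) \<longlonglongrightarrow> 0"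
    by (subst (asm) tendsto_ennreal_iff) auto
  then have "L2_tendsto \<mu> (\<lambda>k. fourier_ell1 (b k)) g"
    by (simp add: L2_tendsto_def L2b L2g)
  then show ?thesis by (rule fourier_pairI[OF b])
qed

text \<open>Discharges the choice in \<open>fourier\<close>: some transform exists, and any function
  with the defining property is a limit of transforms of finite truncations.\<close>

lemma fourier_pair_fourier:
  assumes "a \<in> ell2"
  shows "fourier_pair a (fourier \<mu> a)"
proof -
  obtain g where "fourier_pair a g"
    using fourier_pair_exists assms by (auto simp: ell2_iff_L2_fun)
  then have "is_fourier \<mu> a (fourier \<mu> a)"
    unfolding fourier_def by (intro someI[of "is_fourier \<mu> a"] fourier_pair_imp_is_fourier)
  with assms show ?thesis by (rule is_fourier_imp_fourier_pair)
qed

end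

section \<open>Bessel bounds\<close>

lemma L2_Cauchy_Schwarz:
  assumes u: "L2_fun M u" and v: "L2_fun M v"
  shows integrable_mult_cnj: "integrable M (\<lambda>x. u x * cnj (v x))"
    and "(cmod (\<integral>x. u x * cnj (v x) \<partial>M))\<^sup>2 \<le> sq_integral M u * sq_integral M v"
proof -
  have [measurable]: "u \<in> borel_measurable M" "v \<in> borel_measurable M"
    using u v by (auto dest: L2_fun_measurable)
  have [measurable]: "(\<lambda>x. cnj (v x)) \<in> borel_measurable M"
    using \<open>v \<in> borel_measurable M\<close> by (simp add: borel_measurable_complex_iff)
  have bound: "norm (u x * cnj (v x)) \<le> norm ((cmod (u x))\<^sup>2 + (cmod (v x))\<^sup>2)" for x
  proof -
    have "0 \<le> cmod (u x) * cmod (v x)" by simp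
    then have "cmod (u x) * cmod (v x) \<le> (cmod (u x))\<^sup>2 + (cmod (v x))\<^sup>2"
      using zero_le_power2[of "cmod (u x) - cmod (v x)"] unfolding power2_diff by linarith
    then show ?thesis by (simp add: norm_mult)
  qed
  show int: "integrable M (\<lambda>x. u x * cnj (v x))"
    by (rule Bochner_Integration.integrable_bound[OF
          Bochner_Integration.integrable_add[OF L2_fun_integrable[OF u] L2_fun_integrable[OF v]] _ AE_I2[OF bound]])
      measurable
  let ?I = "\<integral>x. cmod (u x * cnj (v x)) \<partial>M"
  have "ennreal (?I\<^sup>2) = (\<integral>\<^sup>+x. ennreal (cmod (u x * cnj (v x))) \<partial>M)\<^sup>2"
    using int by (subst nn_integral_eq_integral) (auto simp: ennreal_power)
  also have "\<dots> = (\<integral>\<^sup>+x. ennreal (cmod (u x)) * ennreal (cmod (v x)) \<partial>M)\<^sup>2"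
    by (simp add: norm_mult ennreal_mult)
  also have "\<dots> \<le> (\<integral>\<^sup>+x. (ennreal (cmod (u x)))\<^sup>2 \<partial>M) * (\<integral>\<^sup>+x. (ennreal (cmod (v x)))\<^sup>2 \<partial>M)"
    by (rule Cauchy_Schwarz_nn_integral) measurable
  also have "\<dots> = ennreal (sq_integral M u * sq_integral M v)"
    using nn_integral_sq_eq[OF u] nn_integral_sq_eq[OF v] by (simp add: ennreal_power ennreal_mult)
  finally have "?I\<^sup>2 \<le> sq_integral M u * sq_integral M v"
    by (subst (asm) ennreal_le_iff) auto
  moreover have "(cmod (\<integral>x. u x * cnj (v x) \<partial>M))\<^sup>2 \<le> ?I\<^sup>2"
    by (intro power_mono integral_norm_bound) simp
  ultimately show "(cmod (\<integral>x. u x * cnj (v x) \<partial>M))\<^sup>2 \<le> sq_integral M u * sq_integral M v" by linarith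
qed

lemma ell2_inner_eq_integral:
  assumes "x \<in> ell2" "y \<in> ell2"
  shows "ell2_inner x y = (\<integral>i. x i * cnj (y i) \<partial>count_space UNIV)"
  using infsetsum_infsum[of "\<lambda>i. x i * cnj (y i)" UNIV] integrable_mult_cnj[of "count_space UNIV" x y] assms
  by (simp add: ell2_inner_def infsetsum_def Infinite_Set_Sum.abs_summable_on_def ell2_iff_L2_fun)

lemma ell2_Cauchy_Schwarz:
  assumes "x \<in> ell2" "y \<in> ell2"
  shows "(cmod (ell2_inner x y))\<^sup>2 \<le> (ell2_norm x)\<^sup>2 * (ell2_norm y)\<^sup>2"
  using L2_Cauchy_Schwarz(2)[of "count_space UNIV" x y] assms
  by (simp add: ell2_inner_eq_integral ell2_norm_sq ell2_iff_L2_fun)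

lemma ell2_sum: "(\<And>i. i \<in> S \<Longrightarrow> X i \<in> ell2) \<Longrightarrow> (\<lambda>x. \<Sum>i\<in>S. a i * X i x) \<in> ell2"
  unfolding ell2_iff_L2_fun by (intro L2_fun_sum L2_fun_cmult)

lemma ell2_inner_sum_right:
  assumes "x \<in> ell2" "\<And>i. i \<in> S \<Longrightarrow> X i \<in> ell2"
  shows "ell2_inner x (\<lambda>y. \<Sum>i\<in>S. a i * X i y) = (\<Sum>i\<in>S. cnj (a i) * ell2_inner x (X i))"
proof -
  have int: "integrable (count_space UNIV) (\<lambda>y. x y * cnj (X i y))" if "i \<in> S" for i
    using assms that by (intro integrable_mult_cnj) (auto simp: ell2_iff_L2_fun)
  have "ell2_inner x (\<lambda>y. \<Sum>i\<in>S. a i * X i y) = (\<integral>y. (\<Sum>i\<in>S. cnj (a i) * (x y * cnj (X i y))) \<partial>count_space UNIV)"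
    using assms by (subst ell2_inner_eq_integral) (auto intro!: ell2_sum simp: sum_distrib_left mult_ac)
  also have "\<dots> = (\<Sum>i\<in>S. cnj (a i) * (\<integral>y. x y * cnj (X i y) \<partial>count_space UNIV))"
    using int by (subst Bochner_Integration.integral_sum) (auto intro!: integrable_mult_right)
  finally show ?thesis using assms by (simp add: ell2_inner_eq_integral)
qed

lemma ell2_inner_self:
  assumes "x \<in> ell2"
  shows "ell2_inner x x = complex_of_real ((ell2_norm x)\<^sup>2)"
proof -
  have "ell2_inner x x = (\<integral>i. complex_of_real ((cmod (x i))\<^sup>2) \<partial>count_space UNIV)"
    unfolding ell2_inner_eq_integral[OF assms assms] by (simp only: complex_norm_square)
  also have "\<dots> = complex_of_real (sq_integral (count_space UNIV) x)"
    unfolding sq_integral_def by (rule integral_complex_of_real)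
  finally show ?thesis by (simp only: ell2_norm_sq)
qed

text \<open>The analysis and synthesis operators are adjoint, so they have the same norm; done by
  hand on finite sums. One direction tests the Bessel bound on the combination y itself, the other
  takes the coefficients \<open>ell2_inner x (X i)\<close>. Each time Cauchy-Schwarz gives a
  quadratic inequality from which one factor cancels.\<close>

lemma bessel_bound_iff_synthesis:
  fixes X :: "'i \<Rightarrow> 'a \<Rightarrow> complex"
  assumes X: "\<And>i. X i \<in> ell2" and B: "B \<ge> 0"
  shows "bessel_bound X B \<longleftrightarrow>
    (\<forall>S a. finite S \<longrightarrow> (ell2_norm (\<lambda>x. \<Sum>i\<in>S. a i * X i x))\<^sup>2 \<le> B * (\<Sum>i\<in>S. (cmod (a i))\<^sup>2))"
proof (intro iffI allI impI)
  fix S :: "'i set" and a :: "'i \<Rightarrow> complex"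
  assume bound: "bessel_bound X B" and S: "finite S"
  define y where "y x = (\<Sum>i\<in>S. a i * X i x)" for x
  have y: "y \<in> ell2" unfolding y_def[abs_def] by (intro ell2_sum X)
  let ?c = "\<lambda>i. ell2_inner y (X i)" and ?N = "(ell2_norm y)\<^sup>2"
  have "(\<Sum>i\<in>S. (cmod (?c i))\<^sup>2) \<le> infsum (\<lambda>i. (cmod (?c i))\<^sup>2) UNIV"
    using bound y S by (intro finite_sum_le_infsum) (auto simp: bessel_bound_def)
  also have "\<dots> \<le> B * ?N" using bound y by (simp add: bessel_bound_def)
  finally have c: "(\<Sum>i\<in>S. (cmod (?c i))\<^sup>2) \<le> B * ?N" .
  have "complex_of_real ?N = (\<Sum>i\<in>S. cnj (a i) * ?c i)"
    using ell2_inner_sum_right[where X = X and S = S and a = a, OF y X] by (simp only: ell2_inner_self[OF y, symmetric] y_def[symmetric])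
  then have "?N = cmod (\<Sum>i\<in>S. cnj (a i) * ?c i)"
    by (metis abs_of_nonneg norm_of_real zero_le_power2)
  also have "\<dots> \<le> (\<Sum>i\<in>S. cmod (a i) * cmod (?c i))"
    by (rule order_trans[OF norm_sum]) (simp add: norm_mult)
  finally have "?N\<^sup>2 \<le> (\<Sum>i\<in>S. cmod (a i) * cmod (?c i))\<^sup>2" by (intro power_mono) auto
  also have "\<dots> \<le> (\<Sum>i\<in>S. (cmod (a i))\<^sup>2) * (\<Sum>i\<in>S. (cmod (?c i))\<^sup>2)"
    by (rule Cauchy_Schwarz_ineq_sum)
  also have "\<dots> \<le> (\<Sum>i\<in>S. (cmod (a i))\<^sup>2) * (B * ?N)"
    by (intro mult_left_mono c sum_nonneg) auto
  finally have "?N * ?N \<le> (B * (\<Sum>i\<in>S. (cmod (a i))\<^sup>2)) * ?N" by (simp add: power2_eq_square mult_ac)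
  then have "?N \<le> B * (\<Sum>i\<in>S. (cmod (a i))\<^sup>2)"
  \<comment> \<open>Nothing can be cancelled when y has norm 0; there nonnegativity of B
    suffices.\<close>
  proof (cases "?N = 0")
    case True
    have "0 \<le> B * (\<Sum>i\<in>S. (cmod (a i))\<^sup>2)" using B by (intro mult_nonneg_nonneg sum_nonneg) auto
    with True show ?thesis by simp
  next
    case False
    then have "?N > 0" by (metis zero_le_power2 less_eq_real_def)
    with \<open>?N * ?N \<le> _ * ?N\<close> show ?thesis by (simp only: mult_le_cancel_right_pos)
  qed
  then show "(ell2_norm (\<lambda>x. \<Sum>i\<in>S. a i * X i x))\<^sup>2 \<le> B * (\<Sum>i\<in>S. (cmod (a i))\<^sup>2)"
    by (simp only: y_def[abs_def])
next
  assume synth: "\<forall>S a. finite S \<longrightarrow> (ell2_norm (\<lambda>x. \<Sum>i\<in>S. a i * X i x))\<^sup>2 \<le> B * (\<Sum>i\<in>S. (cmod (a i))\<^sup>2)"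
  have fin: "(\<Sum>i\<in>S. (cmod (ell2_inner x (X i)))\<^sup>2) \<le> B * (ell2_norm x)\<^sup>2" if x: "x \<in> ell2" and S: "finite S" for x S
  proof -
    let ?c = "\<lambda>i. ell2_inner x (X i)"
    define s where "s = (\<Sum>i\<in>S. (cmod (?c i))\<^sup>2)"
    define y where "y z = (\<Sum>i\<in>S. ?c i * X i z)" for z
    have y: "y \<in> ell2" unfolding y_def[abs_def] by (intro ell2_sum X)
    have s0: "s \<ge> 0" unfolding s_def by (intro sum_nonneg) auto
    have "ell2_inner x y = (\<Sum>i\<in>S. cnj (?c i) * ?c i)"
      using ell2_inner_sum_right[where X = X and S = S and a = ?c, OF x X] by (simp flip: y_def)
    also have "\<dots> = complex_of_real s"
      unfolding s_def of_real_sum complex_norm_square by (simp only: mult.commute)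
    finally have "s\<^sup>2 = (cmod (ell2_inner x y))\<^sup>2" by simp
    also have "\<dots> \<le> (ell2_norm x)\<^sup>2 * (ell2_norm y)\<^sup>2" by (rule ell2_Cauchy_Schwarz[OF x y])
    also have "\<dots> \<le> (ell2_norm x)\<^sup>2 * (B * s)"
      using synth S by (intro mult_left_mono) (auto simp: y_def[abs_def] s_def)
    finally have "s * s \<le> (B * (ell2_norm x)\<^sup>2) * s" by (simp add: power2_eq_square mult_ac)
    then have "s \<le> B * (ell2_norm x)\<^sup>2"
      using s0 B by (cases "s = 0") (auto simp: mult_le_cancel_right)
    then show ?thesis by (simp add: s_def)
  qed
  show "bessel_bound X B"
    unfolding bessel_bound_def
  proof (intro ballI conjI)
    fix x :: "'a \<Rightarrow> complex" assume x: "x \<in> ell2"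
    show sm: "(\<lambda>i. (cmod (ell2_inner x (X i)))\<^sup>2) summable_on UNIV"
      using fin[OF x] by (intro nonneg_bdd_above_summable_on bdd_aboveI2[where M = "B * (ell2_norm x)\<^sup>2"]) auto
    show "(\<Sum>\<^sub>\<infinity>i. (cmod (ell2_inner x (X i)))\<^sup>2) \<le> B * (ell2_norm x)\<^sup>2"
      by (rule infsum_le_finite_sums[OF sm]) (rule fin[OF x])
  qed
qed

section \<open>Operator norms of complex matrices\<close>

lemma cmod_vec_norm_sq: "(norm (v :: complex^'n))\<^sup>2 = (\<Sum>i\<in>UNIV. (cmod (v $ i))\<^sup>2)"
  by (simp add: norm_vec_def L2_set_def sum_nonneg)

text \<open>The vectors violating the bound form an open set, which is empty if it misses a dense
  set. With countable \<open>D\<close> this serves both almost everywhere statements and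
  measurability of the operator norm.\<close>

lemma onorm_sq_le_iff_dense:
  fixes A :: "complex^'m^'n"
  assumes D: "\<And>X :: (complex^'m) set. open X \<Longrightarrow> X \<noteq> {} \<Longrightarrow> \<exists>d\<in>D. d \<in> X"
  shows "(onorm ((*v) A))\<^sup>2 \<le> c \<longleftrightarrow> 0 \<le> c \<and> (\<forall>v\<in>D. (norm (A *v v))\<^sup>2 \<le> c * (norm v)\<^sup>2)"
proof (intro iffI conjI ballI)
  assume le: "(onorm ((*v) A))\<^sup>2 \<le> c"
  show "0 \<le> c" using le order_trans zero_le_power2 by blast
  show "(norm (A *v v))\<^sup>2 \<le> c * (norm v)\<^sup>2" for v
  proof -
    have "(norm (A *v v))\<^sup>2 \<le> (onorm ((*v) A) * norm v)\<^sup>2"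
      by (intro power_mono onorm) auto
    also have "\<dots> \<le> c * (norm v)\<^sup>2"
      using le by (simp add: power_mult_distrib mult_right_mono)
    finally show ?thesis .
  qed
next
  assume *: "0 \<le> c \<and> (\<forall>v\<in>D. (norm (A *v v))\<^sup>2 \<le> c * (norm v)\<^sup>2)"
  have cont: "continuous_on UNIV ((*v) A)" by (intro linear_continuous_on) simp
  have "open {v. c * (norm v)\<^sup>2 < (norm (A *v v))\<^sup>2}"
    by (intro open_Collect_less continuous_intros cont)
  then have "{v. c * (norm v)\<^sup>2 < (norm (A *v v))\<^sup>2} = {}"
    using D * by (metis (mono_tags, lifting) mem_Collect_eq not_less)
  then have "(norm (A *v v))\<^sup>2 \<le> (sqrt c * norm v)\<^sup>2" for v
    using * by (auto simp: power_mult_distrib not_less)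
  then have "norm (A *v v) \<le> sqrt c * norm v" for v
    by (rule power2_le_imp_le) (use * in simp)
  then have "onorm ((*v) A) \<le> sqrt c" by (rule onorm_le)
  then have "(onorm ((*v) A))\<^sup>2 \<le> (sqrt c)\<^sup>2" by (intro power_mono onorm_pos_le) auto
  then show "(onorm ((*v) A))\<^sup>2 \<le> c" using * by simp
qed

lemma cmod_entry_le_onorm:
  fixes A :: "complex^'m^'n"
  shows "cmod (A $ i $ j) \<le> onorm ((*v) A)"
proof -
  have "A $ i $ j = (A *v axis j 1) $ i"
    by (simp add: matrix_vector_mult_def axis_def if_distrib cong: if_cong)
  also have "cmod \<dots> \<le> norm (A *v axis j 1)" by (rule Finite_Cartesian_Product.norm_nth_le)
  also have "\<dots> \<le> onorm ((*v) A) * norm (axis j 1 :: complex^'m)" by (intro onorm) simp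
  finally show ?thesis by (simp add: norm_axis_1)
qed

text \<open>A crude constant: only boundedness is needed, to pass from bounded entries to a bounded
  operator norm.\<close>

lemma onorm_le_entry_bound:
  fixes A :: "complex^'m^'n"
  assumes "\<And>i j. cmod (A $ i $ j) \<le> C"
  shows "onorm ((*v) A) \<le> real CARD('n) * real CARD('m) * C"
proof (rule onorm_le)
  fix v :: "complex^'m"
  have entry: "cmod ((A *v v) $ i) \<le> real CARD('m) * (C * norm v)" for i
  proof -
    have "cmod ((A *v v) $ i) \<le> (\<Sum>j\<in>UNIV. cmod (A $ i $ j * v $ j))"
      by (simp add: matrix_vector_mult_def norm_sum)
    also have "\<dots> \<le> (\<Sum>j\<in>(UNIV::'m set). C * norm v)"
      by (intro sum_mono) (auto simp: norm_mult intro!: mult_mono assms Finite_Cartesian_Product.norm_nth_le order_trans[OF norm_ge_zero assms])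
    finally show ?thesis by simp
  qed
  have "norm (A *v v) \<le> (\<Sum>i\<in>UNIV. cmod ((A *v v) $ i))"
    unfolding norm_vec_def by (rule L2_set_le_sum) auto
  also have "\<dots> \<le> (\<Sum>i\<in>(UNIV::'n set). real CARD('m) * (C * norm v))"
    by (intro sum_mono entry)
  finally show "norm (A *v v) \<le> real CARD('n) * real CARD('m) * C * norm v" by (simp add: mult_ac)
qed

section \<open>Translations and slices of the semidirect product\<close>

lemma inj_sd_mult:
  assumes "hom_to_Aut \<sigma>"
  shows "inj (sd_mult \<sigma> \<gamma>)"
  by (rule inj_on_inverseI[of _ "sd_mult \<sigma> (sd_inv \<sigma> \<gamma>)"])
    (metis assms sd_mult_assoc sd_mult_inv_left sd_mult_one_left)

lemma left_regular_ell2: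
  assumes "hom_to_Aut \<sigma>" "f \<in> ell2"
  shows "left_regular \<sigma> \<gamma> f \<in> ell2"
  unfolding left_regular_def by (rule ell2_reindex[OF assms(2) inj_sd_mult[OF assms(1)]])

text \<open>Since (n,l) = (n,0)(0,l), its inverse first applies the inverse of (n,0), which merely
  subtracts n from the first coordinate.\<close>

lemma left_regular_slice:
  assumes "hom_to_Aut \<sigma>"
  shows "left_regular \<sigma> (n, l) f (m, h) = f (sd_mult \<sigma> (sd_inv \<sigma> (0, l)) (m - n, h))"
proof -
  have "\<sigma> k 0 = 0" for k
    using hom_to_Aut_add[OF assms, of k 0 0] by simp
  then show ?thesis
    by (simp add: left_regular_def sd_mult_def sd_inv_def algebra_simps flip: hom_to_Aut_add[OF assms])
qed

lemma sq_integral_count_space_prod: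
  fixes y :: "'a \<times> 'b::finite \<Rightarrow> complex"
  assumes y: "y \<in> ell2"
  shows "sq_integral (count_space UNIV) y = (\<Sum>h\<in>UNIV. sq_integral (count_space UNIV) (\<lambda>m. y (m, h)))"
proof -
  let ?g = "\<lambda>h x. if snd x = h then (cmod (y x))\<^sup>2 else 0"
  have int: "integrable (count_space UNIV) (?g h)" for h
    using y unfolding ell2_iff_L2_fun
    by (intro Bochner_Integration.integrable_bound[OF L2_fun_integrable[of _ y]]) auto
  have "sq_integral (count_space UNIV) y = (\<integral>x. (\<Sum>h\<in>UNIV. ?g h x) \<partial>count_space UNIV)"
    by (simp add: sq_integral_def)
  also have "\<dots> = (\<Sum>h\<in>UNIV. \<integral>x. ?g h x \<partial>count_space UNIV)"
    by (intro Bochner_Integration.integral_sum int)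
  also have "\<dots> = (\<Sum>h\<in>UNIV. sq_integral (count_space UNIV) (\<lambda>m. y (m, h)))"
  proof (intro sum.cong refl)
    fix h
    have "(\<integral>x. ?g h x \<partial>count_space UNIV) = infsum (?g h) UNIV"
      by (simp add: infsum_eq_integral_count_space)
    also have "\<dots> = infsum (\<lambda>x. (cmod (y x))\<^sup>2) (range (\<lambda>m. (m, h)))"
      by (intro infsum_cong_neutral) auto
    also have "\<dots> = infsum (\<lambda>m. (cmod (y (m, h)))\<^sup>2) UNIV"
      by (subst infsum_reindex) (auto simp: inj_on_def comp_def)
    finally show "(\<integral>x. ?g h x \<partial>count_space UNIV) = sq_integral (count_space UNIV) (\<lambda>m. y (m, h))"
      by (simp add: infsum_eq_integral_count_space sq_integral_def)
  qed
  finally show ?thesis .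
qed

text \<open>The essential supremum is an extended real; the bound C and the nonzero total mass make
  it a nonnegative real, which is the least almost everywhere bound.\<close>

lemma esssup_ereal_eqI:
  fixes g :: "'a \<Rightarrow> real"
  assumes g: "g \<in> borel_measurable M" "\<And>x. 0 \<le> g x" and M: "emeasure M (space M) \<noteq> 0"
    and C: "AE x in M. g x \<le> C"
  obtains B where "0 \<le> B" "ereal B = esssup M (\<lambda>x. ereal (g x))" "AE x in M. g x \<le> B"
    "\<And>B'. AE x in M. g x \<le> B' \<Longrightarrow> B \<le> B'"
proof -
  let ?E = "esssup M (\<lambda>x. ereal (g x))"
  have meas: "(\<lambda>x. ereal (g x)) \<in> borel_measurable M" using g(1) by simp
  have le: "?E \<le> ereal B'" if "AE x in M. g x \<le> B'" for B'
    using that by (intro esssup_I meas) auto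
  have "esssup M (\<lambda>x. 0 :: ereal) \<le> ?E"
    using g(2) by (intro esssup_mono) auto
  then have "0 \<le> ?E" by (simp add: esssup_const[OF M])
  with le[OF C] obtain B where B: "?E = ereal B" by (cases ?E) auto
  have "AE x in M. ereal (g x) \<le> ?E" by (rule esssup_AE)
  then have "AE x in M. g x \<le> B" by (simp add: B)
  with that[of B] B \<open>0 \<le> ?E\<close> le show thesis by auto
qed

section \<open>Bessel bounds of the orbit and the transfer matrix\<close>

locale transfer = dual_haar \<mu> for \<mu> :: "('n::ab_group_add \<Rightarrow> complex) measure" +
  fixes \<sigma> :: "'h::{group_add,finite} \<Rightarrow> 'n \<Rightarrow> 'n" and f :: "'n \<times> 'h \<Rightarrow> complex"
  assumes hom: "hom_to_Aut \<sigma>" and f: "f \<in> ell2"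
begin

abbreviation F :: "('n \<Rightarrow> complex) \<Rightarrow> ((complex, 'h) vec, 'h) vec" where
  "F \<equiv> transfer_matrix \<mu> \<sigma> f"

abbreviation synthesis :: "('n \<times> 'h) set \<Rightarrow> ('n \<times> 'h \<Rightarrow> complex) \<Rightarrow> 'n \<times> 'h \<Rightarrow> complex" where
  "synthesis S a \<equiv> \<lambda>\<eta>. \<Sum>\<gamma>\<in>S. a \<gamma> * left_regular \<sigma> \<gamma> f \<eta>"

text \<open>Entry l is the Fourier transform of the coefficients on the l-th copy of
  \<open>N\<close>, cut down to \<open>S\<close>.\<close>

definition symbol :: "'n set \<Rightarrow> ('n \<times> 'h \<Rightarrow> complex) \<Rightarrow> ('n \<Rightarrow> complex) \<Rightarrow> (complex, 'h) vec" where
  "symbol S a \<xi> = (\<chi> l. \<Sum>n\<in>S. a (n, l) * \<xi> (- n))"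

lemma slice_fourier_pair:
  "fourier_pair (\<lambda>n. f (sd_mult \<sigma> (sd_inv \<sigma> (0, l)) (n, h))) (\<lambda>\<xi>. F \<xi> $ h $ l)"
proof -
  have "inj (\<lambda>n. sd_mult \<sigma> (sd_inv \<sigma> (0, l)) (n, h))"
    using inj_sd_mult[OF hom] by (auto simp: inj_def)
  from fourier_pair_fourier[OF ell2_reindex[OF f this]]
  show ?thesis by (simp add: transfer_matrix_def)
qed

lemma entry_L2: "L2_fun \<mu> (\<lambda>\<xi>. F \<xi> $ h $ l)"
  by (rule fourier_pair_L2(2)[OF slice_fourier_pair])

lemma entry_measurable [measurable]: "(\<lambda>\<xi>. F \<xi> $ h $ l) \<in> borel_measurable \<mu>"
  by (rule L2_fun_measurable[OF entry_L2])

text \<open>Shifts by n become factors \<xi>(-n), and the sum over l becomes the matrix product; h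
  selects the slice of the output and thus the row.\<close>

lemma synthesis_fourier_pair:
  "fourier_pair (\<lambda>m. synthesis (S \<times> UNIV) a (m, h)) (\<lambda>\<xi>. (F \<xi> *v symbol S a \<xi>) $ h)"
proof -
  have "fourier_pair (\<lambda>m. \<Sum>l\<in>UNIV. \<Sum>n\<in>S. a (n, l) * f (sd_mult \<sigma> (sd_inv \<sigma> (0, l)) (m - n, h)))
      (\<lambda>\<xi>. \<Sum>l\<in>UNIV. \<Sum>n\<in>S. a (n, l) * (\<xi> (- n) * F \<xi> $ h $ l))"
    by (intro fourier_pair_sum fourier_pair_cmult fourier_pair_shift[OF slice_fourier_pair])
  moreover have "(\<lambda>m. \<Sum>l\<in>UNIV. \<Sum>n\<in>S. a (n, l) * f (sd_mult \<sigma> (sd_inv \<sigma> (0, l)) (m - n, h)))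
      = (\<lambda>m. synthesis (S \<times> UNIV) a (m, h))"
    by (subst sum.swap) (simp add: sum.cartesian_product' left_regular_slice[OF hom])
  moreover have "(\<lambda>\<xi>. \<Sum>l\<in>UNIV. \<Sum>n\<in>S. a (n, l) * (\<xi> (- n) * F \<xi> $ h $ l))
      = (\<lambda>\<xi>. (F \<xi> *v symbol S a \<xi>) $ h)"
    by (simp add: fun_eq_iff matrix_vector_mult_def symbol_def sum_distrib_left mult_ac)
  ultimately show ?thesis by simp
qed

lemma integrable_synthesis_symbol: "integrable \<mu> (\<lambda>\<xi>. (norm (F \<xi> *v symbol S a \<xi>))\<^sup>2)"
  unfolding cmod_vec_norm_sq
  by (intro Bochner_Integration.integrable_sum L2_fun_integrable fourier_pair_L2[OF synthesis_fourier_pair])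

lemma norm_synthesis:
  "(ell2_norm (synthesis (S \<times> UNIV) a))\<^sup>2 = (\<integral>\<xi>. (norm (F \<xi> *v symbol S a \<xi>))\<^sup>2 \<partial>\<mu>)"
proof -
  have "synthesis (S \<times> UNIV) a \<in> ell2"
    by (intro ell2_sum left_regular_ell2 hom f)
  then have "(ell2_norm (synthesis (S \<times> UNIV) a))\<^sup>2
      = (\<Sum>h\<in>UNIV. sq_integral (count_space UNIV) (\<lambda>m. synthesis (S \<times> UNIV) a (m, h)))"
    unfolding ell2_norm_sq by (rule sq_integral_count_space_prod)
  also have "\<dots> = (\<Sum>h\<in>UNIV. sq_integral \<mu> (\<lambda>\<xi>. (F \<xi> *v symbol S a \<xi>) $ h))"
    by (intro sum.cong refl fourier_pair_parseval[OF synthesis_fourier_pair, symmetric])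
  also have "\<dots> = (\<integral>\<xi>. (norm (F \<xi> *v symbol S a \<xi>))\<^sup>2 \<partial>\<mu>)"
    unfolding cmod_vec_norm_sq sq_integral_def
    by (intro Bochner_Integration.integral_sum[symmetric] L2_fun_integrable
        fourier_pair_L2[OF synthesis_fourier_pair])
  finally show ?thesis .
qed

lemma symbol_L2: "finite S \<Longrightarrow> L2_fun \<mu> (\<lambda>\<xi>. symbol S a \<xi> $ l)"
  unfolding symbol_def by (intro L2_fun_trig_poly trig_polyI[of S _ "\<lambda>n. a (n, l)"]) auto

lemma integrable_symbol: "finite S \<Longrightarrow> integrable \<mu> (\<lambda>\<xi>. (norm (symbol S a \<xi>))\<^sup>2)"
  unfolding cmod_vec_norm_sq by (intro Bochner_Integration.integrable_sum L2_fun_integrable symbol_L2)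

lemma norm_symbol:
  assumes "finite S"
  shows "(\<integral>\<xi>. (norm (symbol S a \<xi>))\<^sup>2 \<partial>\<mu>) = (\<Sum>\<gamma>\<in>S \<times> UNIV. (cmod (a \<gamma>))\<^sup>2)"
proof -
  have "(\<integral>\<xi>. (norm (symbol S a \<xi>))\<^sup>2 \<partial>\<mu>) = (\<Sum>l\<in>UNIV. sq_integral \<mu> (\<lambda>\<xi>. symbol S a \<xi> $ l))"
    unfolding cmod_vec_norm_sq sq_integral_def
    by (intro Bochner_Integration.integral_sum L2_fun_integrable symbol_L2 assms)
  also have "\<dots> = (\<Sum>l\<in>UNIV. \<Sum>n\<in>S. (cmod (a (n, l)))\<^sup>2)"
    by (simp add: symbol_def sq_integral_trig_poly[OF assms])
  also have "\<dots> = (\<Sum>\<gamma>\<in>S \<times> UNIV. (cmod (a \<gamma>))\<^sup>2)"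
    by (subst sum.swap) (simp add: sum.cartesian_product')
  finally show ?thesis .
qed

lemma bessel_bound_iff_symbol:
  assumes B: "B \<ge> 0"
  shows "bessel_bound (\<lambda>\<gamma>. left_regular \<sigma> \<gamma> f) B \<longleftrightarrow> (\<forall>S a. finite S \<longrightarrow>
    (\<integral>\<xi>. (norm (F \<xi> *v symbol S a \<xi>))\<^sup>2 \<partial>\<mu>) \<le> B * (\<integral>\<xi>. (norm (symbol S a \<xi>))\<^sup>2 \<partial>\<mu>))"
  (is "_ \<longleftrightarrow> ?R")
proof -
  have "bessel_bound (\<lambda>\<gamma>. left_regular \<sigma> \<gamma> f) B \<longleftrightarrow> (\<forall>T a. finite T \<longrightarrow>
      (ell2_norm (synthesis T a))\<^sup>2 \<le> B * (\<Sum>\<gamma>\<in>T. (cmod (a \<gamma>))\<^sup>2))"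
    by (intro bessel_bound_iff_synthesis left_regular_ell2 hom f B)
  also have "\<dots> \<longleftrightarrow> ?R"
  proof (intro iffI allI impI)
    fix S :: "'n set" and a :: "'n \<times> 'h \<Rightarrow> complex"
    assume *: "\<forall>T a. finite T \<longrightarrow> (ell2_norm (synthesis T a))\<^sup>2 \<le> B * (\<Sum>\<gamma>\<in>T. (cmod (a \<gamma>))\<^sup>2)"
      and S: "finite S"
    have "finite (S \<times> (UNIV :: 'h set))" using S by simp
    with * have "(ell2_norm (synthesis (S \<times> UNIV) a))\<^sup>2 \<le> B * (\<Sum>\<gamma>\<in>S \<times> UNIV. (cmod (a \<gamma>))\<^sup>2)"
      by blast
    then show "(\<integral>\<xi>. (norm (F \<xi> *v symbol S a \<xi>))\<^sup>2 \<partial>\<mu>) \<le> B * (\<integral>\<xi>. (norm (symbol S a \<xi>))\<^sup>2 \<partial>\<mu>)"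
      by (simp only: norm_synthesis norm_symbol[OF S])
  next
    fix T :: "('n \<times> 'h) set" and a :: "'n \<times> 'h \<Rightarrow> complex"
    assume R: ?R and T: "finite T"
    \<comment> \<open>A symbol needs a full rectangle of indices, so T is enlarged to one and the
      new coefficients are 0.\<close>
    define S where "S = fst ` T"
    define a' where "a' \<gamma> = (if \<gamma> \<in> T then a \<gamma> else 0)" for \<gamma>
    have S: "finite S" "finite (S \<times> (UNIV :: 'h set))" "T \<subseteq> S \<times> UNIV"
      using T by (auto simp: S_def intro: rev_image_eqI)
    have "synthesis T a = synthesis (S \<times> UNIV) a'"
      using S T by (intro ext sum.mono_neutral_cong_left) (auto simp: a'_def)
    moreover have "(\<Sum>\<gamma>\<in>T. (cmod (a \<gamma>))\<^sup>2) = (\<Sum>\<gamma>\<in>S \<times> UNIV. (cmod (a' \<gamma>))\<^sup>2)"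
      using S T by (intro sum.mono_neutral_cong_left) (auto simp: a'_def)
    ultimately show "(ell2_norm (synthesis T a))\<^sup>2 \<le> B * (\<Sum>\<gamma>\<in>T. (cmod (a \<gamma>))\<^sup>2)"
      using R S(1) by (simp only: norm_synthesis flip: norm_symbol[OF S(1)])
  qed
  finally show ?thesis .
qed

text \<open>
  Testing the symbol inequality on \<open>q v\<close> with a real trigonometric polynomial \<open>q\<close> and a constant
  vector \<open>v\<close> makes \<open>B \<parallel>v\<parallel>\<^sup>2 - \<parallel>F v\<parallel>\<^sup>2\<close> nonnegative against all \<open>q\<^sup>2\<close>, hence almost everywhere.
\<close>

lemma AE_vector_bound:
  assumes B: "B \<ge> 0" and bound: "bessel_bound (\<lambda>\<gamma>. left_regular \<sigma> \<gamma> f) B"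
  shows "AE \<xi> in \<mu>. (norm (F \<xi> *v v))\<^sup>2 \<le> B * (norm v)\<^sup>2"
proof -
  have const: "integrable \<mu> (\<lambda>\<xi>. (norm (F \<xi> *v v))\<^sup>2)"
    unfolding cmod_vec_norm_sq matrix_vector_mult_def
    by (auto intro!: Bochner_Integration.integrable_sum L2_fun_integrable L2_fun_sum L2_fun_cmult entry_L2
        simp: mult.commute[of _ "v $ _"])
  have "AE \<xi> in \<mu>. 0 \<le> B * (norm v)\<^sup>2 - (norm (F \<xi> *v v))\<^sup>2"
  proof (rule AE_nonneg_if_trig_poly)
    show "integrable \<mu> (\<lambda>\<xi>. B * (norm v)\<^sup>2 - (norm (F \<xi> *v v))\<^sup>2)"
      using const by simp
    fix q :: "('n \<Rightarrow> complex) \<Rightarrow> real" assume "real_trig_poly q"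
    then obtain S c where S: "finite S" "\<And>\<xi>. \<xi> \<in> dual_group \<Longrightarrow> complex_of_real (q \<xi>) = (\<Sum>n\<in>S. c n * \<xi> (- n))"
      by (auto simp: trig_poly_def)
    \<comment> \<open>The coefficients of q times the constant vector v.\<close>
    define a where "a = (\<lambda>(n, l). c n * v $ l)"
    have sym: "symbol S a \<xi> = q \<xi> *\<^sub>R v" if "\<xi> \<in> space \<mu>" for \<xi>
      using that S(2)[of \<xi>]
      by (simp add: space_mu symbol_def a_def vec_eq_iff scaleR_conv_of_real[where 'a = complex]
          sum_distrib_left mult_ac)
    have sym_norm: "(norm (symbol S a \<xi>))\<^sup>2 = (q \<xi>)\<^sup>2 * (norm v)\<^sup>2" if "\<xi> \<in> space \<mu>" for \<xi>
      by (simp add: sym[OF that] power_mult_distrib)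
    have F_norm: "(norm (F \<xi> *v symbol S a \<xi>))\<^sup>2 = (q \<xi>)\<^sup>2 * (norm (F \<xi> *v v))\<^sup>2" if "\<xi> \<in> space \<mu>" for \<xi>
      by (simp add: sym[OF that] power_mult_distrib linear_scale[OF matrix_vector_mul_linear])
    have "(\<integral>\<xi>. (norm (F \<xi> *v symbol S a \<xi>))\<^sup>2 \<partial>\<mu>) \<le> B * (\<integral>\<xi>. (norm (symbol S a \<xi>))\<^sup>2 \<partial>\<mu>)"
      using bound S(1) bessel_bound_iff_symbol[OF B] by blast
    then have "0 \<le> (\<integral>\<xi>. B * (norm (symbol S a \<xi>))\<^sup>2 - (norm (F \<xi> *v symbol S a \<xi>))\<^sup>2 \<partial>\<mu>)"
      using integrable_symbol[OF S(1)] integrable_synthesis_symbol by simp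
    also have "\<dots> = (\<integral>\<xi>. (q \<xi>)\<^sup>2 * (B * (norm v)\<^sup>2 - (norm (F \<xi> *v v))\<^sup>2) \<partial>\<mu>)"
      by (rule Bochner_Integration.integral_cong) (simp_all add: sym_norm F_norm algebra_simps)
    finally show "0 \<le> (\<integral>\<xi>. (q \<xi>)\<^sup>2 * (B * (norm v)\<^sup>2 - (norm (F \<xi> *v v))\<^sup>2) \<partial>\<mu>)" .
  qed
  then show ?thesis by simp
qed

text \<open>The null set of \<open>AE_vector_bound\<close> depends on v; a countable dense set of
  vectors yields one null set for all. Conversely the pointwise bound is integrated.\<close>

lemma bessel_bound_iff_AE_onorm:
  assumes B: "B \<ge> 0"
  shows "bessel_bound (\<lambda>\<gamma>. left_regular \<sigma> \<gamma> f) B \<longleftrightarrow> (AE \<xi> in \<mu>. (onorm ((*v) (F \<xi>)))\<^sup>2 \<le> B)"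
proof
  assume bound: "bessel_bound (\<lambda>\<gamma>. left_regular \<sigma> \<gamma> f) B"
  obtain D :: "((complex, 'h) vec) set" where D: "countable D" "\<And>X. open X \<Longrightarrow> X \<noteq> {} \<Longrightarrow> \<exists>d\<in>D. d \<in> X"
    using countable_dense_setE by blast
  have "AE \<xi> in \<mu>. \<forall>v\<in>D. (norm (F \<xi> *v v))\<^sup>2 \<le> B * (norm v)\<^sup>2"
    by (intro AE_ball_countable'[OF _ D(1)] AE_vector_bound[OF B bound])
  then show "AE \<xi> in \<mu>. (onorm ((*v) (F \<xi>)))\<^sup>2 \<le> B"
    using B by (simp add: onorm_sq_le_iff_dense[OF D(2)])
next
  assume AE: "AE \<xi> in \<mu>. (onorm ((*v) (F \<xi>)))\<^sup>2 \<le> B"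
  show "bessel_bound (\<lambda>\<gamma>. left_regular \<sigma> \<gamma> f) B"
    unfolding bessel_bound_iff_symbol[OF B]
  proof (intro allI impI)
    fix S :: "'n set" and a :: "'n \<times> 'h \<Rightarrow> complex" assume S: "finite S"
    have "(\<integral>\<xi>. (norm (F \<xi> *v symbol S a \<xi>))\<^sup>2 \<partial>\<mu>) \<le> (\<integral>\<xi>. B * (norm (symbol S a \<xi>))\<^sup>2 \<partial>\<mu>)"
    proof (rule integral_mono_AE[OF integrable_synthesis_symbol])
      show "integrable \<mu> (\<lambda>\<xi>. B * (norm (symbol S a \<xi>))\<^sup>2)"
        using integrable_symbol[OF S] by simp
      show "AE \<xi> in \<mu>. (norm (F \<xi> *v symbol S a \<xi>))\<^sup>2 \<le> B * (norm (symbol S a \<xi>))\<^sup>2"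
        using AE
      proof eventually_elim
        fix \<xi> assume "(onorm ((*v) (F \<xi>)))\<^sup>2 \<le> B"
        then show "(norm (F \<xi> *v symbol S a \<xi>))\<^sup>2 \<le> B * (norm (symbol S a \<xi>))\<^sup>2"
          using onorm_sq_le_iff_dense[of UNIV "F \<xi>" B] by auto
      qed
    qed
    then show "(\<integral>\<xi>. (norm (F \<xi> *v symbol S a \<xi>))\<^sup>2 \<partial>\<mu>) \<le> B * (\<integral>\<xi>. (norm (symbol S a \<xi>))\<^sup>2 \<partial>\<mu>)"
      by simp
  qed
qed

lemma onorm_measurable: "(\<lambda>\<xi>. (onorm ((*v) (F \<xi>)))\<^sup>2) \<in> borel_measurable \<mu>"
proof -
  obtain D :: "((complex, 'h) vec) set" where D: "countable D" "\<And>X. open X \<Longrightarrow> X \<noteq> {} \<Longrightarrow> \<exists>d\<in>D. d \<in> X"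
    using countable_dense_setE by blast
  have [measurable]: "(\<lambda>\<xi>. (norm (F \<xi> *v v))\<^sup>2) \<in> borel_measurable \<mu>" for v
    unfolding cmod_vec_norm_sq matrix_vector_mult_def by simp
  have iff: "(onorm ((*v) A))\<^sup>2 \<le> c \<longleftrightarrow> 0 \<le> c \<and> (\<forall>v\<in>D. (norm (A *v v))\<^sup>2 \<le> c * (norm v)\<^sup>2)"
    for A :: "((complex, 'h) vec, 'h) vec" and c
    by (rule onorm_sq_le_iff_dense) (rule D(2))
  have "{\<xi> \<in> space \<mu>. 0 \<le> c \<and> (\<forall>v\<in>D. (norm (F \<xi> *v v))\<^sup>2 \<le> c * (norm v)\<^sup>2)} \<in> sets \<mu>" for c
    using D(1) by measurable
  then show ?thesis
    unfolding borel_measurable_iff_le iff by blast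
qed

lemma bessel_sequence_iff:
  "bessel_sequence (\<lambda>\<gamma>. left_regular \<sigma> \<gamma> f) \<longleftrightarrow> (\<exists>B. AE \<xi> in \<mu>. (onorm ((*v) (F \<xi>)))\<^sup>2 \<le> B)"
proof
  assume "bessel_sequence (\<lambda>\<gamma>. left_regular \<sigma> \<gamma> f)"
  then show "\<exists>B. AE \<xi> in \<mu>. (onorm ((*v) (F \<xi>)))\<^sup>2 \<le> B"
    using bessel_bound_iff_AE_onorm by (auto simp: bessel_sequence_def dest: less_imp_le)
next
  assume "\<exists>B. AE \<xi> in \<mu>. (onorm ((*v) (F \<xi>)))\<^sup>2 \<le> B"
  then obtain B where "AE \<xi> in \<mu>. (onorm ((*v) (F \<xi>)))\<^sup>2 \<le> B" by blast
  \<comment> \<open>\<open>bessel_sequence\<close> demands a strictly positive bound, while B may be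
    0.\<close>
  then have "AE \<xi> in \<mu>. (onorm ((*v) (F \<xi>)))\<^sup>2 \<le> max B 1" by eventually_elim simp
  then have "bessel_bound (\<lambda>\<gamma>. left_regular \<sigma> \<gamma> f) (max B 1)"
    by (simp add: bessel_bound_iff_AE_onorm)
  then show "bessel_sequence (\<lambda>\<gamma>. left_regular \<sigma> \<gamma> f)"
    by (auto simp: bessel_sequence_def left_regular_ell2 hom f intro!: exI[of _ "max B 1"])
qed

lemma bessel_sequence_iff_Linf:
  "bessel_sequence (\<lambda>\<gamma>. left_regular \<sigma> \<gamma> f) \<longleftrightarrow> (\<forall>h l. Linf_fun \<mu> (\<lambda>\<xi>. F \<xi> $ h $ l))"
  unfolding bessel_sequence_iff
proof
  assume "\<exists>B. AE \<xi> in \<mu>. (onorm ((*v) (F \<xi>)))\<^sup>2 \<le> B"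
  then obtain B where B: "AE \<xi> in \<mu>. (onorm ((*v) (F \<xi>)))\<^sup>2 \<le> B" by blast
  have "AE \<xi> in \<mu>. cmod (F \<xi> $ h $ l) \<le> sqrt B" for h l
    using B
  proof eventually_elim
    fix \<xi> assume le: "(onorm ((*v) (F \<xi>)))\<^sup>2 \<le> B"
    have "cmod (F \<xi> $ h $ l) \<le> onorm ((*v) (F \<xi>))" by (rule cmod_entry_le_onorm)
    also have "\<dots> \<le> sqrt B" by (rule real_le_rsqrt[OF le])
    finally show "cmod (F \<xi> $ h $ l) \<le> sqrt B" .
  qed
  then show "\<forall>h l. Linf_fun \<mu> (\<lambda>\<xi>. F \<xi> $ h $ l)"
    by (auto simp: Linf_fun_def)
next
  assume "\<forall>h l. Linf_fun \<mu> (\<lambda>\<xi>. F \<xi> $ h $ l)"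
  then obtain C where C: "\<And>h l. AE \<xi> in \<mu>. cmod (F \<xi> $ h $ l) \<le> C h l"
    unfolding Linf_fun_def by metis
  define K where "K = (\<Sum>h\<in>UNIV. \<Sum>l\<in>UNIV. \<bar>C h l\<bar>)"
  have CK: "C h l \<le> K" for h l
  proof -
    have "C h l \<le> \<bar>C h l\<bar>" by simp
    also have "\<dots> \<le> (\<Sum>l\<in>UNIV. \<bar>C h l\<bar>)" by (intro member_le_sum) auto
    also have "\<dots> \<le> K" unfolding K_def by (intro member_le_sum sum_nonneg) auto
    finally show ?thesis .
  qed
  have "AE \<xi> in \<mu>. \<forall>h l. cmod (F \<xi> $ h $ l) \<le> C h l"
    using C by (simp add: AE_all_countable)
  then have "AE \<xi> in \<mu>. (onorm ((*v) (F \<xi>)))\<^sup>2 \<le> (real CARD('h) * real CARD('h) * K)\<^sup>2"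
  proof eventually_elim
    fix \<xi> assume "\<forall>h l. cmod (F \<xi> $ h $ l) \<le> C h l"
    then have "cmod (F \<xi> $ h $ l) \<le> K" for h l using CK order_trans by blast
    then show "(onorm ((*v) (F \<xi>)))\<^sup>2 \<le> (real CARD('h) * real CARD('h) * K)\<^sup>2"
      by (intro power_mono onorm_le_entry_bound onorm_pos_le) simp_all
  qed
  then show "\<exists>B. AE \<xi> in \<mu>. (onorm ((*v) (F \<xi>)))\<^sup>2 \<le> B" by blast
qed

text \<open>Bessel bounds and almost everywhere bounds of the squared operator norm are the same
  nonnegative numbers, hence so are the least ones.\<close>

lemma optimal_bound:
  assumes "bessel_sequence (\<lambda>\<gamma>. left_regular \<sigma> \<gamma> f)"
  shows "\<exists>B. optimal_bessel_bound (\<lambda>\<gamma>. left_regular \<sigma> \<gamma> f) B \<and>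
    ereal B = esssup \<mu> (\<lambda>\<xi>. ereal (lambda_max (conj_transpose (F \<xi>) ** F \<xi>)))"
proof -
  obtain C where C: "AE \<xi> in \<mu>. (onorm ((*v) (F \<xi>)))\<^sup>2 \<le> C"
    using assms bessel_sequence_iff by blast
  obtain B where "0 \<le> B" "ereal B = esssup \<mu> (\<lambda>\<xi>. ereal ((onorm ((*v) (F \<xi>)))\<^sup>2))"
    "AE \<xi> in \<mu>. (onorm ((*v) (F \<xi>)))\<^sup>2 \<le> B"
    "\<And>B'. AE \<xi> in \<mu>. (onorm ((*v) (F \<xi>)))\<^sup>2 \<le> B' \<Longrightarrow> B \<le> B'"
    by (rule esssup_ereal_eqI[OF onorm_measurable _ _ C]) (simp_all add: emeasure_space_1)
  then show ?thesis
    by (auto simp: optimal_bessel_bound_def bessel_bound_iff_AE_onorm lambda_max_gram intro!: exI[of _ B])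
qed

end

theorem theorem5:
  fixes \<sigma> :: "'h::{group_add,finite} \<Rightarrow> 'n::ab_group_add \<Rightarrow> 'n"
    and \<mu> :: "('n \<Rightarrow> complex) measure"
    and f :: "'n \<times> 'h \<Rightarrow> complex"
  assumes "hom_to_Aut \<sigma>"
    and "haar_dual \<mu>"
    and "f \<in> ell2"
  shows "(bessel_sequence (\<lambda>\<gamma>. left_regular \<sigma> \<gamma> f) \<longleftrightarrow>
            (\<forall>h l. Linf_fun \<mu> (\<lambda>\<xi>. transfer_matrix \<mu> \<sigma> f \<xi> $ h $ l))) \<and>
         (bessel_sequence (\<lambda>\<gamma>. left_regular \<sigma> \<gamma> f) \<longrightarrow>
            (\<exists>B. optimal_bessel_bound (\<lambda>\<gamma>. left_regular \<sigma> \<gamma> f) B \<and>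
                 ereal B = esssup \<mu> (\<lambda>\<xi>. ereal (lambda_max
                   (conj_transpose (transfer_matrix \<mu> \<sigma> f \<xi>) ** transfer_matrix \<mu> \<sigma> f \<xi>)))))"
proof -
  interpret transfer \<mu> \<sigma> f
    by unfold_locales (use assms in auto)
  show ?thesis using bessel_sequence_iff_Linf optimal_bound by blast
qed

end
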